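(* Let $\phi=(f_1,\ldots,f_n)\colon\mathbb{C}^m\dashrightarrow\mathbb{C}^n$ be a rational map and let $X=\overline{\mathrm{im}(\phi)}$. Let $U_\phi=\{p\in\mathbb{C}^m\mid \mathrm{rk}\, J_\phi(p)=\dim X\}$. Then $U_\phi$ contains a Zariski open dense subset of $\mathbb{C}^m$, and $$\mathfrak{g}_X=\{A\in\mathfrak{gl}_n(\mathbb{C})\mid A.\phi(p)\in \mathrm{im}\, J_\phi(p)\text{ for all } p\in U_\phi\}.$$
   Context: Closures are Zariski closures. $G_X=\{g\in\mathrm{GL}_n(\mathbb{C})\mid gX=X\}$ is a Zariski closed subgroup of $\mathrm{GL}_n(\mathbb{C})$, and $\mathfrak{g}_X\subseteq\mathfrak{gl}_n(\mathbb{C})$ is its Lie algebra. The Jacobian map is $J_\phi\colon\mathbb{C}^m\dashrightarrow\mathbb{C}^{n\times m}$, $p\mapsto\left(\frac{\partial f_i}{\partial x_j}(p)\right)_{i,j}$; $\mathrm{im}\,J_\phi(p)\subseteq\mathbb{C}^n$ is the column space of $J_\phi(p)$. Points of $U_\phi$ are understood to be points at which $\phi$ is defined. *)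

theory Defs
  imports
    "HOL-Analysis.Analysis"
    "HOL-Library.Poly_Mapping"
    "HOL-Computational_Algebra.Fraction_Field"
begin

hide_const (open) Poly_Mapping.range Poly_Mapping.degree

section \<open>Polynomials and rational functions\<close>

text \<open>A polynomial is a finitely supported map from exponent vectors to coefficients.\<close>

type_synonym 'i cpoly = "('i \<Rightarrow>\<^sub>0 nat) \<Rightarrow>\<^sub>0 complex"

definition pmonom :: "('i \<Rightarrow>\<^sub>0 nat) \<Rightarrow> ('i \<Rightarrow> complex) \<Rightarrow> complex" where
  "pmonom e x = (\<Prod>i\<in>Poly_Mapping.keys e. x i ^ Poly_Mapping.lookup e i)"

definition peval :: "'i cpoly \<Rightarrow> ('i \<Rightarrow> complex) \<Rightarrow> complex" where
  "peval p x = (\<Sum>e\<in>Poly_Mapping.keys p. Poly_Mapping.lookup p e * pmonom e x)"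

text \<open>The field of rational functions. The linear order on the index type is needed only because
  the library's integral-domain instance for polynomials asks for one.\<close>

type_synonym 'm ratfun = "'m cpoly fract"

text \<open>A rational function is defined at \<open>x\<close> if \<^emph>\<open>some\<close> representation as a fraction has a
  denominator that does not vanish at \<open>x\<close>.\<close>

definition rat_defined_at :: "'m::{finite,linorder} ratfun \<Rightarrow> complex^'m::{finite,linorder} \<Rightarrow> bool" where
  "rat_defined_at f x \<longleftrightarrow> (\<exists>a b. f = Fract a b \<and> peval b (($) x) \<noteq> 0)"

definition rat_eval :: "'m::{finite,linorder} ratfun \<Rightarrow> complex^'m::{finite,linorder} \<Rightarrow> complex" where
  "rat_eval f x =
     (THE v. \<exists>a b. f = Fract a b \<and> peval b (($) x) \<noteq> 0 \<and> v = peval a (($) x) / peval b (($) x))"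

lemma pmonom_superset:
  assumes "finite S" "Poly_Mapping.keys e \<subseteq> S"
  shows "pmonom e x = (\<Prod>i\<in>S. x i ^ Poly_Mapping.lookup e i)"
  unfolding pmonom_def
  by (rule prod.mono_neutral_left) (use assms in \<open>auto simp: in_keys_iff\<close>)

lemma pmonom_add: "pmonom (d + e) x = pmonom d x * pmonom e x"
proof -
  let ?S = "Poly_Mapping.keys d \<union> Poly_Mapping.keys e"
  have "Poly_Mapping.keys (d + e) \<subseteq> ?S"
    by (rule Poly_Mapping.keys_add)
  then show ?thesis
    using pmonom_superset[of ?S "d + e" x] pmonom_superset[of ?S d x] pmonom_superset[of ?S e x]
    by (simp add: lookup_add power_add prod.distrib)
qed

lemma peval_superset:
  assumes "finite S" "Poly_Mapping.keys p \<subseteq> S"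
  shows "peval p x = (\<Sum>e\<in>S. Poly_Mapping.lookup p e * pmonom e x)"
  unfolding peval_def
  by (rule sum.mono_neutral_left) (use assms in \<open>auto simp: in_keys_iff\<close>)

lemma peval_0 [simp]: "peval 0 x = 0"
  by (simp add: peval_def)

lemma peval_single [simp]: "peval (Poly_Mapping.single e c) x = c * pmonom e x"
  by (simp add: peval_def)

lemma peval_1 [simp]: "peval 1 x = 1"
  using peval_single[of 0 1 x] by (simp add: pmonom_def)

lemma peval_add: "peval (p + q) x = peval p x + peval q x"
proof -
  let ?S = "Poly_Mapping.keys p \<union> Poly_Mapping.keys q"
  have "Poly_Mapping.keys (p + q) \<subseteq> ?S"
    by (rule Poly_Mapping.keys_add)
  then show ?thesis
    using peval_superset[of ?S "p + q" x] peval_superset[of ?S p x] peval_superset[of ?S q x]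
    by (simp add: lookup_add sum.distrib distrib_right)
qed

lemma peval_sum: "peval (\<Sum>i\<in>I. g i) x = (\<Sum>i\<in>I. peval (g i) x)"
  by (induction I rule: infinite_finite_induct) (auto simp: peval_add)

lemma cpoly_sum_single:
  "p = (\<Sum>e\<in>Poly_Mapping.keys p. Poly_Mapping.single e (Poly_Mapping.lookup p e))"
  by (rule poly_mapping_eqI)
     (auto simp: lookup_sum lookup_single when_def in_keys_iff sum.delta)

lemma peval_mult: "peval (p * q) x = peval p x * peval q x"
proof -
  let ?s = "\<lambda>p e. Poly_Mapping.single e (Poly_Mapping.lookup p e)"
  have "p * q = (\<Sum>d\<in>Poly_Mapping.keys p. \<Sum>e\<in>Poly_Mapping.keys q. ?s p d * ?s q e)"
    using arg_cong2[OF cpoly_sum_single[of p] cpoly_sum_single[of q], of "(*)"]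
    by (simp only: sum_product)
  then show ?thesis
    by (simp add: peval_sum mult_single pmonom_add peval_def[of p] peval_def[of q] sum_product
        mult_ac)
qed

lemma rat_eval_Fract:
  assumes "peval b (($) x) \<noteq> 0"
  shows "rat_eval (Fract a b) x = peval a (($) x) / peval b (($) x)"
  unfolding rat_eval_def
proof (rule the_equality)
  fix v
  assume "\<exists>a' b'. Fract a b = Fract a' b' \<and> peval b' (($) x) \<noteq> 0 \<and>
            v = peval a' (($) x) / peval b' (($) x)"
  then obtain a' b' where *: "Fract a b = Fract a' b'" "peval b' (($) x) \<noteq> 0"
    "v = peval a' (($) x) / peval b' (($) x)" by blast
  have "b \<noteq> 0" "b' \<noteq> 0" using assms * by auto
  with * have "a * b' = a' * b" by (simp add: eq_fract)
  then have "peval a (($) x) * peval b' (($) x) = peval a' (($) x) * peval b (($) x)"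
    by (metis peval_mult)
  then show "v = peval a (($) x) / peval b (($) x)"
    unfolding *(3) using assms *(2) by (simp add: frac_eq_eq)
qed (use assms in blast)


section \<open>Zariski topology and dimension\<close>

definition zariski :: "(complex^'n) topology" where
  "zariski = topology (\<lambda>U. \<exists>P :: 'n cpoly set. U = {x. \<exists>p\<in>P. peval p (($) x) \<noteq> 0})"

lemma openin_zariski:
  fixes U :: "(complex^'n) set"
  shows "openin zariski U \<longleftrightarrow> (\<exists>P :: 'n cpoly set. U = {x. \<exists>p\<in>P. peval p (($) x) \<noteq> 0})"
proof -
  define D :: "'n cpoly set \<Rightarrow> (complex^'n) set"
    where "D = (\<lambda>P. {x. \<exists>p\<in>P. peval p (($) x) \<noteq> 0})"
  have D: "x \<in> D P \<longleftrightarrow> (\<exists>p\<in>P. peval p (($) x) \<noteq> 0)" for x P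
    by (simp add: D_def)
  have Int: "D P \<inter> D Q = D (\<Union>p\<in>P. (*) p ` Q)" for P Q
  proof (rule set_eqI)
    fix x
    have "x \<in> D P \<inter> D Q \<longleftrightarrow> (\<exists>p\<in>P. \<exists>q\<in>Q. peval (p * q) (($) x) \<noteq> 0)"
      unfolding Int_iff D peval_mult mult_eq_0_iff by blast
    also have "\<dots> \<longleftrightarrow> x \<in> D (\<Union>p\<in>P. (*) p ` Q)"
      unfolding D by blast
    finally show "x \<in> D P \<inter> D Q \<longleftrightarrow> x \<in> D (\<Union>p\<in>P. (*) p ` Q)" .
  qed
  have Un: "\<Union>(D ` F) = D (\<Union>F)" for F
    by (rule set_eqI) (simp only: UN_iff D Union_iff bex_simps, blast)
  have ist: "istopology (\<lambda>U. U \<in> range D)"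
    unfolding istopology_def
  proof (intro conjI allI impI)
    fix S T assume "S \<in> range D" "T \<in> range D"
    then show "S \<inter> T \<in> range D" by (elim rangeE) (simp add: Int)
  next
    fix K assume "\<forall>U\<in>K. U \<in> range D"
    then have "K \<subseteq> range D" by (simp add: subset_iff)
    then obtain F where "K = D ` F" by (auto simp: subset_image_iff)
    then show "\<Union>K \<in> range D" by (simp add: Un)
  qed
  have Z: "zariski = topology (\<lambda>U. U \<in> range D)"
    by (simp add: zariski_def D_def image_iff)
  have "openin zariski U \<longleftrightarrow> U \<in> range D"
    unfolding Z by (rule fun_cong[OF topology_inverse'[OF ist]])
  then show ?thesis
    by (simp add: D_def image_iff)
qed

lemma topspace_zariski [simp]: "topspace zariski = UNIV"
proof -
  have "openin zariski (UNIV :: (complex^'n) set)"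
    unfolding openin_zariski by (rule exI[of _ "{1}"]) simp
  then show ?thesis
    by (rule top.extremum_uniqueI[OF openin_subset])
qed

lemma closedin_zariski:
  fixes S :: "(complex^'n) set"
  shows "closedin zariski S \<longleftrightarrow> (\<exists>P :: 'n cpoly set. S = {x. \<forall>p\<in>P. peval p (($) x) = 0})"
proof -
  have "UNIV - S = {x. \<exists>p\<in>P. peval p (($) x) \<noteq> 0} \<longleftrightarrow> S = {x. \<forall>p\<in>P. peval p (($) x) = 0}"
    for P :: "'n cpoly set"
    by (simp add: set_eq_iff) metis
  then show ?thesis
    by (simp only: closedin_def topspace_zariski openin_zariski subset_UNIV simp_thms)
qed

definition irreducible_in :: "'a topology \<Rightarrow> 'a set \<Rightarrow> bool" where
  "irreducible_in T Z \<longleftrightarrow> Z \<subseteq> topspace T \<and> Z \<noteq> {} \<and>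
     (\<forall>A B. closedin T A \<longrightarrow> closedin T B \<longrightarrow> Z \<subseteq> A \<union> B \<longrightarrow> Z \<subseteq> A \<or> Z \<subseteq> B)"

text \<open>Krull dimension: the supremum of the lengths \<open>k\<close> of chains
  \<open>C 0 \<subset> C 1 \<subset> \<dots> \<subset> C k\<close> of irreducible closed subsets.\<close>

definition krull_dim :: "'a topology \<Rightarrow> enat" where
  "krull_dim T = Sup {enat k |k. \<exists>C :: nat \<Rightarrow> 'a set.
     (\<forall>i\<le>k. closedin T (C i) \<and> irreducible_in T (C i)) \<and> (\<forall>i<k. C i \<subset> C (Suc i))}"

definition zariski_dim :: "(complex^'n) set \<Rightarrow> enat" where
  "zariski_dim X = krull_dim (subtopology zariski X)"


section \<open>Rational maps\<close>

type_synonym ('m, 'n) ratmap = "('m ratfun)^'n"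

definition defined_at :: "('m::{finite,linorder}, 'n::finite) ratmap \<Rightarrow> complex^'m::{finite,linorder} \<Rightarrow> bool" where
  "defined_at \<phi> p \<longleftrightarrow> (\<forall>i. rat_defined_at (\<phi> $ i) p)"

definition map_eval :: "('m::{finite,linorder}, 'n::finite) ratmap \<Rightarrow> complex^'m::{finite,linorder} \<Rightarrow> complex^'n" where
  "map_eval \<phi> p = (\<chi> i. rat_eval (\<phi> $ i) p)"

definition image_closure :: "('m::{finite,linorder}, 'n::finite) ratmap \<Rightarrow> (complex^'n) set" where
  "image_closure \<phi> = zariski closure_of (map_eval \<phi> ` {p. defined_at \<phi> p})"

text \<open>The \<open>(i, j)\<close> entry is the complex partial derivative of the \<open>i\<close>-th component in the \<open>j\<close>-th
  coordinate. It is meaningful at points where \<open>\<phi>\<close> is defined, as these form an open set on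
  which \<open>\<phi>\<close> is holomorphic.\<close>

definition rat_jacobian ::
    "('m::{finite,linorder}, 'n::finite) ratmap \<Rightarrow> complex^'m::{finite,linorder} \<Rightarrow> complex^'m::{finite,linorder}^'n" where
  "rat_jacobian \<phi> p =
     (\<chi> i j. deriv (\<lambda>z. rat_eval (\<phi> $ i) (\<chi> k. if k = j then z else p $ k)) (p $ j))"

definition full_rank_locus ::
    "('m::{finite,linorder}, 'n::finite) ratmap \<Rightarrow> (complex^'m::{finite,linorder}) set" where
  "full_rank_locus \<phi> =
     {p. defined_at \<phi> p \<and> enat (rank (rat_jacobian \<phi> p)) = zariski_dim (image_closure \<phi>)}"


section \<open>The linear symmetry group and its Lie algebra\<close>

definition sym_group :: "(complex^'n) set \<Rightarrow> (complex^'n^'n) set" where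
  "sym_group X = {g. invertible g \<and> (\<lambda>x. g *v x) ` X = X}"

text \<open>The Lie algebra of a Zariski closed subgroup \<open>G\<close> of the general linear group is its tangent
  space at the identity: the matrices \<open>A\<close> along which every polynomial in the matrix entries
  vanishing on \<open>G\<close> has derivative zero at the identity. Inverting the determinant, a unit on the
  general linear group, would impose no further conditions.\<close>

definition lie_algebra :: "(complex^'n^'n) set \<Rightarrow> (complex^'n^'n) set" where
  "lie_algebra G =
     {A. \<forall>f :: ('n \<times> 'n) cpoly.
           (\<forall>g\<in>G. peval f (\<lambda>(i, j). g $ i $ j) = 0) \<longrightarrow>
           deriv (\<lambda>t. peval f (\<lambda>(i, j). mat 1 $ i $ j + t * A $ i $ j)) 0 = 0}"

end

theory Submission
  imports Defs "HOL-Complex_Analysis.Cauchy_Integral_Formula"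
begin

text \<open>
  Write \<open>X\<close> for the closure of the image of \<open>\<phi>\<close>, \<open>J\<close> for the Jacobian matrix, \<open>r\<close> for its maximal rank on
  the domain of definition, and \<open>I\<close> for the ideal of polynomials vanishing on \<open>X\<close>. On the complement
  of a common denominator \<open>h\<close> the map and its Jacobian consist of regular functions, and a product of
  nonzero regular functions is nonzero; so finitely many conditions that hold generically hold
  simultaneously at some point. As linear independence of columns is an open condition
  (\<open>indep_columns_open\<close>), the rank is \<open>r\<close> on a dense open set.

  \<^emph>\<open>The dimension of \<open>X\<close> is \<open>r\<close>.\<close> In characteristic zero algebraically independent functions of \<open>\<phi>\<close>
  number at most \<open>r\<close> (\<open>card_alg_indep_le_rank\<close>): extend them by coordinate functions as far as possible;
  the remaining coordinates satisfy separable relations over them, and differentiating these relations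
  shows that the Jacobian is injective on a subspace of the right dimension. This uses that
  more functions than coordinates are algebraically dependent, which is a count of monomials
  (\<open>not_alg_indep_on_slice\<close>). A chain of irreducible closed subsets of \<open>X\<close> of length \<open>k\<close> yields \<open>k\<close>
  algebraically independent functions on \<open>X\<close>, namely functions separating consecutive members
  (\<open>alg_indep_chain\<close>); hence \<open>k \<le> r\<close>. Conversely, the closures of the images of a flag of coordinate
  subspaces through a point of rank \<open>r\<close>, in directions of independent columns, form a chain of length
  \<open>r\<close> (\<open>rank_le_zariski_dim\<close>).

  \<^emph>\<open>The Lie algebra.\<close> A matrix \<open>A\<close> acts on polynomials as the derivation \<open>p \<mapsto> Dp(x)(A x)\<close>, and it lies in
  the Lie algebra of the symmetry group of \<open>X\<close> if and only if this derivation preserves \<open>I\<close>. For one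
  direction, \<open>p (g x) = 0\<close> is a polynomial equation satisfied by all symmetries \<open>g\<close>, to be differentiated at
  the identity; for the other, all derivatives of \<open>t \<mapsto> p (exp (t A) x)\<close> vanish at \<open>t = 0\<close>, so that \<open>exp (t A)\<close> is a
  curve of symmetries with tangent \<open>A\<close>. It remains to compare this with \<open>A \<phi>(q) \<in> im J(q)\<close>. If the latter
  holds wherever the rank is \<open>r\<close>, then by the chain rule \<open>A p\<close> vanishes generically on the image for each
  \<open>p\<close> in \<open>I\<close>, hence on \<open>X\<close>. If the derivation preserves \<open>I\<close>, then at a generic point \<open>q\<close> both \<open>A \<phi>(q)\<close> and the
  column space of \<open>J(q)\<close> lie in the common kernel of the gradients of suitable relations, whose dimension
  is at most \<open>r\<close>. At a special point \<open>p\<close> of rank \<open>r\<close> the image \<open>\<phi>(p)\<close> may be singular on \<open>X\<close> and its tangent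
  space too large; but if \<open>A \<phi>(p)\<close> were outside \<open>im J(p)\<close>, the augmented matrix would have rank \<open>r + 1\<close> at \<open>p\<close> and
  therefore at a generic point as well (\<open>tangent_in_range_jacobian\<close>).
\<close>

section \<open>Polynomials\<close>

definition Const :: "complex \<Rightarrow> 'i cpoly" where
  "Const c = Poly_Mapping.single 0 c"

definition Var :: "'i \<Rightarrow> 'i cpoly" where
  "Var i = Poly_Mapping.single (Poly_Mapping.single i 1) 1"

definition vars :: "'i cpoly \<Rightarrow> 'i set" where
  "vars p = (\<Union>e\<in>Poly_Mapping.keys p. Poly_Mapping.keys e)"

lemma finite_vars [simp]: "finite (vars p)"
  by (simp add: vars_def)

lemma pmonom_0 [simp]: "pmonom 0 x = 1"
  by (simp add: pmonom_def)

lemma pmonom_single [simp]: "pmonom (Poly_Mapping.single i n) x = x i ^ n"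
  by (simp add: pmonom_def)

lemma peval_Const [simp]: "peval (Const c) x = c"
  by (simp add: Const_def)

lemma peval_Var [simp]: "peval (Var i) x = x i"
  by (simp add: Var_def)

lemma peval_power: "peval (p ^ n) x = peval p x ^ n"
  by (induction n) (auto simp: peval_mult)

lemma peval_prod: "peval (\<Prod>i\<in>I. g i) x = (\<Prod>i\<in>I. peval (g i) x)"
  by (induction I rule: infinite_finite_induct) (auto simp: peval_mult)

lemma peval_diff: "peval (p - q) x = peval p x - peval q x"
  using peval_add[of "p - q" q x] by simp

text \<open>Polynomials are generated from constants and variables by the ring operations, so that a
  property of polynomial functions only has to be checked on these.\<close>

lemma single_exponent_induct:
  fixes Q :: "'i cpoly \<Rightarrow> bool"
  assumes c: "\<And>c. Q (Const c)" and v: "\<And>i. Q (Var i)"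
    and m: "\<And>p q. Q p \<Longrightarrow> Q q \<Longrightarrow> Q (p * q)"
  shows "Q (Poly_Mapping.single e c)"
proof -
  have pw: "Q (Poly_Mapping.single (Poly_Mapping.single i n) 1)" for i n
  proof (induction n)
    case 0
    then show ?case using c[of 1] by (simp add: Const_def)
  next
    case (Suc n)
    have "Poly_Mapping.single (Poly_Mapping.single i (Suc n)) (1::complex)
        = Var i * Poly_Mapping.single (Poly_Mapping.single i n) 1"
      by (simp add: Var_def mult_single single_add[symmetric])
    then show ?case using Suc m v by metis
  qed
  have "Q (Poly_Mapping.single (\<Sum>i\<in>I. Poly_Mapping.single i (Poly_Mapping.lookup e i)) c)" if "finite I" for I
    using that
  proof (induction I)
    case empty
    then show ?case using c[of c] by (simp add: Const_def)
  next
    case (insert i I)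
    have "Poly_Mapping.single (\<Sum>i\<in>insert i I. Poly_Mapping.single i (Poly_Mapping.lookup e i)) c
        = Poly_Mapping.single (Poly_Mapping.single i (Poly_Mapping.lookup e i)) 1 *
          Poly_Mapping.single (\<Sum>i\<in>I. Poly_Mapping.single i (Poly_Mapping.lookup e i)) c"
      using insert by (simp add: mult_single)
    then show ?case using insert m pw by metis
  qed
  moreover have "e = (\<Sum>i\<in>Poly_Mapping.keys e. Poly_Mapping.single i (Poly_Mapping.lookup e i))"
    by (rule poly_mapping_eqI) (auto simp: lookup_sum lookup_single when_def in_keys_iff sum.delta)
  ultimately show ?thesis by (metis finite_keys)
qed

lemma cpoly_induct [case_names const var add mult]:
  fixes Q :: "'i cpoly \<Rightarrow> bool"
  assumes c: "\<And>c. Q (Const c)" and v: "\<And>i. Q (Var i)"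
    and a: "\<And>p q. Q p \<Longrightarrow> Q q \<Longrightarrow> Q (p + q)" and m: "\<And>p q. Q p \<Longrightarrow> Q q \<Longrightarrow> Q (p * q)"
  shows "Q p"
proof -
  have "Q (\<Sum>e\<in>I. Poly_Mapping.single e (Poly_Mapping.lookup p e))" if "finite I" for I
    using that
  proof (induction I)
    case empty
    then show ?case using c[of 0] by (simp add: Const_def)
  next
    case (insert e I)
    then show ?case using a single_exponent_induct[of Q, OF c v m] by simp
  qed
  then show ?thesis using cpoly_sum_single[of p] by (metis finite_keys)
qed

lemma vars_empty_imp_Const:
  assumes "vars p = {}" shows "p = Const (Poly_Mapping.lookup p 0)"
proof (rule poly_mapping_eqI)
  fix e
  have "e = 0" if "Poly_Mapping.lookup p e \<noteq> 0"
  proof (rule poly_mapping_eqI)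
    fix i
    have "Poly_Mapping.keys e \<subseteq> vars p"
      unfolding vars_def using that by (intro UN_upper) (simp add: in_keys_iff)
    then have "i \<notin> Poly_Mapping.keys e" using assms by simp
    then show "Poly_Mapping.lookup e i = Poly_Mapping.lookup 0 i" by (simp add: in_keys_iff)
  qed
  then show "Poly_Mapping.lookup p e = Poly_Mapping.lookup (Const (Poly_Mapping.lookup p 0)) e"
    by (cases "e = 0") (auto simp: Const_def lookup_single)
qed

lemma ex_subst: "\<exists>q. \<forall>x. peval q x = peval p (\<lambda>i. peval (s i) x)"
proof (induction p rule: cpoly_induct)
  case (const c)
  then show ?case by (metis peval_Const)
next
  case (var i)
  then show ?case by (metis peval_Var)
next
  case (add p q)
  then show ?case by (metis peval_add)
next
  case (mult p q)
  then show ?case by (metis peval_mult)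
qed

text \<open>Restricted to a line, a polynomial function becomes a polynomial in one variable. This reduces
  statements on zeros to the finiteness of the zero set of a nonzero polynomial in one variable.\<close>

lemma ex_poly_on_line: "\<exists>u. \<forall>t. peval p (\<lambda>i. x i + t * y i) = poly u t"
proof (induction p rule: cpoly_induct)
  case (const c)
  show ?case by (rule exI[of _ "[:c:]"]) simp
next
  case (var i)
  show ?case by (rule exI[of _ "[:x i, y i:]"]) simp
next
  case (add p q)
  then obtain u v where "\<forall>t. peval p (\<lambda>i. x i + t * y i) = poly u t"
    "\<forall>t. peval q (\<lambda>i. x i + t * y i) = poly v t" by blast
  then show ?case by (intro exI[of _ "u + v"]) (simp add: peval_add)
next
  case (mult p q)
  then obtain u v where "\<forall>t. peval p (\<lambda>i. x i + t * y i) = poly u t"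
    "\<forall>t. peval q (\<lambda>i. x i + t * y i) = poly v t" by blast
  then show ?case by (intro exI[of _ "u * v"]) (simp add: peval_mult)
qed

lemma keys_sum_single_subset:
  assumes "finite A"
  shows "Poly_Mapping.keys (\<Sum>e\<in>A. Poly_Mapping.single (g e) (c e)) \<subseteq> g ` A"
  using assms
proof (induction A)
  case (insert e A)
  then show ?case
    using Poly_Mapping.keys_add[of "Poly_Mapping.single (g e) (c e)" "\<Sum>e\<in>A. Poly_Mapping.single (g e) (c e)"]
    by (auto split: if_splits)
qed simp

text \<open>Division with remainder by a variable; the last conclusion bounds the degree of the quotient.\<close>

lemma cpoly_split_variable:
  fixes p :: "'i cpoly"
  obtains p0 q where "p = p0 + Var k * q" "vars p0 \<subseteq> vars p - {k}" "vars q \<subseteq> vars p"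
    "\<And>e. e \<in> Poly_Mapping.keys q \<Longrightarrow> e + Poly_Mapping.single k 1 \<in> Poly_Mapping.keys p"
proof -
  let ?A = "{e\<in>Poly_Mapping.keys p. Poly_Mapping.lookup e k = 0}"
  let ?B = "{e\<in>Poly_Mapping.keys p. Poly_Mapping.lookup e k \<noteq> 0}"
  let ?s = "Poly_Mapping.single k (1::nat)"
  define p0 where "p0 = (\<Sum>e\<in>?A. Poly_Mapping.single e (Poly_Mapping.lookup p e))"
  define q where "q = (\<Sum>e\<in>?B. Poly_Mapping.single (e - ?s) (Poly_Mapping.lookup p e))"
  have unshift: "e - ?s + ?s = e" if "Poly_Mapping.lookup e k \<noteq> 0" for e
    by (rule poly_mapping_eqI) (use that in \<open>auto simp: lookup_add lookup_minus lookup_single when_def\<close>)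
  have "Var k * q = (\<Sum>e\<in>?B. Poly_Mapping.single e (Poly_Mapping.lookup p e))"
    unfolding q_def sum_distrib_left Var_def mult_single
    by (intro sum.cong refl) (use unshift in \<open>simp add: add.commute\<close>)
  then have "p0 + Var k * q = (\<Sum>e\<in>?A \<union> ?B. Poly_Mapping.single e (Poly_Mapping.lookup p e))"
    unfolding p0_def by (subst sum.union_disjoint) auto
  also have "?A \<union> ?B = Poly_Mapping.keys p" by auto
  finally have split: "p = p0 + Var k * q" using cpoly_sum_single[of p] by simp
  have kp0: "Poly_Mapping.keys p0 \<subseteq> ?A"
    unfolding p0_def using keys_sum_single_subset[of ?A "\<lambda>e. e"] by simp
  have vp0: "vars p0 \<subseteq> vars p - {k}"
  proof
    fix j assume "j \<in> vars p0"
    then obtain e where "e \<in> ?A" "j \<in> Poly_Mapping.keys e" using kp0 by (auto simp: vars_def)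
    then show "j \<in> vars p - {k}" by (auto simp: vars_def in_keys_iff)
  qed
  have kq: "e + ?s \<in> Poly_Mapping.keys p" if "e \<in> Poly_Mapping.keys q" for e
  proof -
    have "Poly_Mapping.keys q \<subseteq> (\<lambda>e. e - ?s) ` ?B"
      unfolding q_def by (rule keys_sum_single_subset) simp
    then show ?thesis using that unshift by auto
  qed
  have vq: "vars q \<subseteq> vars p"
  proof
    fix j assume "j \<in> vars q"
    then obtain e where e: "e \<in> Poly_Mapping.keys q" "j \<in> Poly_Mapping.keys e" by (auto simp: vars_def)
    then have "j \<in> Poly_Mapping.keys (e + ?s)" by (auto simp: in_keys_iff lookup_add)
    then show "j \<in> vars p" using kq[OF e(1)] by (auto simp: vars_def)
  qed
  show thesis by (rule that[OF split vp0 vq kq])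
qed

subsection \<open>Formal partial derivatives\<close>

text \<open>The truncated subtraction of exponents is harmless: where it truncates, the coefficient is zero.\<close>

definition pd :: "'i \<Rightarrow> 'i cpoly \<Rightarrow> 'i cpoly" where
  "pd i p = (\<Sum>e\<in>Poly_Mapping.keys p. Poly_Mapping.single (e - Poly_Mapping.single i 1)
     (of_nat (Poly_Mapping.lookup e i) * Poly_Mapping.lookup p e))"

lemma lookup_pd:
  "Poly_Mapping.lookup (pd i p) e = of_nat (Suc (Poly_Mapping.lookup e i)) * Poly_Mapping.lookup p (e + Poly_Mapping.single i 1)"
proof -
  let ?d = "e + Poly_Mapping.single i (1::nat)"
  have eq: "d = ?d \<longleftrightarrow> d - Poly_Mapping.single i 1 = e" if "Poly_Mapping.lookup d i \<noteq> 0" for d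
  proof
    assume "d - Poly_Mapping.single i 1 = e"
    moreover have "d = d - Poly_Mapping.single i 1 + Poly_Mapping.single i 1"
      by (rule poly_mapping_eqI) (use that in \<open>auto simp: lookup_add lookup_minus lookup_single when_def\<close>)
    ultimately show "d = ?d" by simp
  qed simp
  have "Poly_Mapping.lookup (pd i p) e = (\<Sum>d\<in>Poly_Mapping.keys p.
      if d = ?d then of_nat (Poly_Mapping.lookup ?d i) * Poly_Mapping.lookup p ?d else 0)"
    unfolding pd_def lookup_sum
  proof (rule sum.cong[OF refl])
    fix d assume "d \<in> Poly_Mapping.keys p"
    show "Poly_Mapping.lookup (Poly_Mapping.single (d - Poly_Mapping.single i 1)
        (of_nat (Poly_Mapping.lookup d i) * Poly_Mapping.lookup p d)) e =
      (if d = ?d then of_nat (Poly_Mapping.lookup ?d i) * Poly_Mapping.lookup p ?d else 0)"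
      using eq[of d] by (cases "Poly_Mapping.lookup d i = 0") (auto simp: lookup_single when_def)
  qed
  also have "\<dots> = of_nat (Poly_Mapping.lookup ?d i) * Poly_Mapping.lookup p ?d"
    by (simp add: sum.delta in_keys_iff)
  finally show ?thesis by (simp add: lookup_add)
qed

lemma keys_pd_subset:
  assumes "e \<in> Poly_Mapping.keys (pd i p)" shows "e + Poly_Mapping.single i 1 \<in> Poly_Mapping.keys p"
  using assms by (auto simp: in_keys_iff lookup_pd)

lemma vars_pd: "vars (pd i p) \<subseteq> vars p"
proof
  fix j assume "j \<in> vars (pd i p)"
  then obtain e where "e \<in> Poly_Mapping.keys (pd i p)" "Poly_Mapping.lookup e j \<noteq> 0"
    by (auto simp: vars_def in_keys_iff)
  then have "Poly_Mapping.lookup (e + Poly_Mapping.single i 1) j \<noteq> 0"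
    "e + Poly_Mapping.single i 1 \<in> Poly_Mapping.keys p"
    using keys_pd_subset by (auto simp: lookup_add)
  then show "j \<in> vars p" by (auto simp: vars_def in_keys_iff)
qed

lemma pd_eq_0_imp_not_in_vars:
  assumes "pd i p = 0" shows "i \<notin> vars p"
proof
  assume "i \<in> vars p"
  then obtain d where d: "Poly_Mapping.lookup p d \<noteq> 0" "Poly_Mapping.lookup d i \<noteq> 0"
    by (auto simp: vars_def in_keys_iff)
  have "d - Poly_Mapping.single i 1 + Poly_Mapping.single i 1 = d"
    by (rule poly_mapping_eqI) (use d in \<open>auto simp: lookup_add lookup_minus lookup_single when_def\<close>)
  then have "Poly_Mapping.lookup (pd i p) (d - Poly_Mapping.single i 1) \<noteq> 0"
    using d by (simp only: lookup_pd) (simp del: of_nat_Suc)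
  then show False using assms by simp
qed

lemma pd_eq_0_if_not_in_vars:
  assumes "i \<notin> vars p" shows "pd i p = 0"
proof (rule poly_mapping_eqI)
  fix e
  have "e + Poly_Mapping.single i 1 \<notin> Poly_Mapping.keys p"
  proof
    assume "e + Poly_Mapping.single i 1 \<in> Poly_Mapping.keys p"
    moreover have "i \<in> Poly_Mapping.keys (e + Poly_Mapping.single i 1)" by (simp add: in_keys_iff lookup_add)
    ultimately show False using assms unfolding vars_def by blast
  qed
  then show "Poly_Mapping.lookup (pd i p) e = Poly_Mapping.lookup 0 e"
    unfolding lookup_pd by (simp add: in_keys_iff)
qed

lemma pmonom_has_derivative:
  fixes g :: "'i \<Rightarrow> 'a::real_normed_vector \<Rightarrow> complex"
  assumes I: "finite I" "Poly_Mapping.keys e \<subseteq> I"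
    and g: "\<And>i. i \<in> I \<Longrightarrow> (g i has_derivative g' i) (at x)"
  shows "((\<lambda>x. pmonom e (\<lambda>i. g i x)) has_derivative
     (\<lambda>v. \<Sum>i\<in>I. of_nat (Poly_Mapping.lookup e i) * pmonom (e - Poly_Mapping.single i 1) (\<lambda>i. g i x) * g' i v)) (at x)"
proof -
  let ?l = "Poly_Mapping.lookup e"
  have "((\<lambda>x. \<Prod>i\<in>I. g i x ^ ?l i) has_derivative
     (\<lambda>v. \<Sum>i\<in>I. (of_nat (?l i) * g' i v * g i x ^ (?l i - 1)) * (\<Prod>j\<in>I - {i}. g j x ^ ?l j))) (at x)"
    by (intro has_derivative_prod has_derivative_power g)
  moreover have "pmonom (e - Poly_Mapping.single i 1) (\<lambda>i. g i x) = g i x ^ (?l i - 1) * (\<Prod>j\<in>I - {i}. g j x ^ ?l j)"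
    if "i \<in> I" for i
  proof -
    have "Poly_Mapping.keys (e - Poly_Mapping.single i 1) \<subseteq> I"
      using I(2) by (auto simp: in_keys_iff lookup_minus)
    then have "pmonom (e - Poly_Mapping.single i 1) (\<lambda>i. g i x) =
        (\<Prod>j\<in>I. g j x ^ Poly_Mapping.lookup (e - Poly_Mapping.single i 1) j)"
      by (rule pmonom_superset[OF I(1)])
    also have "\<dots> = g i x ^ (?l i - 1) * (\<Prod>j\<in>I - {i}. g j x ^ Poly_Mapping.lookup (e - Poly_Mapping.single i 1) j)"
      by (subst prod.remove[OF I(1) that]) (simp add: lookup_minus)
    also have "(\<Prod>j\<in>I - {i}. g j x ^ Poly_Mapping.lookup (e - Poly_Mapping.single i 1) j) = (\<Prod>j\<in>I - {i}. g j x ^ ?l j)"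
      by (rule prod.cong) (auto simp: lookup_minus lookup_single when_def)
    finally show ?thesis .
  qed
  ultimately show ?thesis
    by (simp add: pmonom_superset[OF I] mult_ac cong: sum.cong)
qed

text \<open>The chain rule identifies the formal derivatives with the analytic ones.\<close>

lemma peval_has_derivative:
  fixes g :: "'i \<Rightarrow> 'a::real_normed_vector \<Rightarrow> complex"
  assumes I: "finite I" "vars p \<subseteq> I"
    and g: "\<And>i. i \<in> I \<Longrightarrow> (g i has_derivative g' i) (at x)"
  shows "((\<lambda>x. peval p (\<lambda>i. g i x)) has_derivative
     (\<lambda>v. \<Sum>i\<in>I. peval (pd i p) (\<lambda>i. g i x) * g' i v)) (at x)"
proof -
  have "((\<lambda>x. \<Sum>e\<in>Poly_Mapping.keys p. Poly_Mapping.lookup p e * pmonom e (\<lambda>i. g i x)) has_derivative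
     (\<lambda>v. \<Sum>e\<in>Poly_Mapping.keys p. Poly_Mapping.lookup p e *
       (\<Sum>i\<in>I. of_nat (Poly_Mapping.lookup e i) * pmonom (e - Poly_Mapping.single i 1) (\<lambda>i. g i x) * g' i v))) (at x)"
    using I by (intro has_derivative_sum has_derivative_mult_right pmonom_has_derivative g)
      (auto simp: vars_def)
  moreover have "(\<Sum>e\<in>Poly_Mapping.keys p. Poly_Mapping.lookup p e *
       (\<Sum>i\<in>I. of_nat (Poly_Mapping.lookup e i) * pmonom (e - Poly_Mapping.single i 1) (\<lambda>i. g i x) * g' i v))
     = (\<Sum>i\<in>I. peval (pd i p) (\<lambda>i. g i x) * g' i v)" for v
    unfolding pd_def peval_sum peval_single sum_distrib_left sum_distrib_right
    by (subst sum.swap) (simp add: mult_ac)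
  ultimately show ?thesis by (simp add: peval_def[of p])
qed

lemma peval_has_field_derivative:
  assumes "finite I" "vars p \<subseteq> I" "\<And>i. i \<in> I \<Longrightarrow> (g i has_field_derivative g' i) (at t)"
  shows "((\<lambda>t. peval p (\<lambda>i. g i t)) has_field_derivative
     (\<Sum>i\<in>I. peval (pd i p) (\<lambda>i. g i t) * g' i)) (at t)"
proof -
  have "(\<lambda>v. \<Sum>i\<in>I. peval (pd i p) (\<lambda>i. g i t) * (g' i * v)) = (*) (\<Sum>i\<in>I. peval (pd i p) (\<lambda>i. g i t) * g' i)"
    by (rule ext) (simp add: sum_distrib_right mult.assoc)
  with peval_has_derivative[of I p g "\<lambda>i. (*) (g' i)" t] assms show ?thesis
    unfolding has_field_derivative_def by simp
qed

subsection \<open>Algebraic independence\<close>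

text \<open>Vanishing at every point of \<open>D\<close> stands for being zero in the coordinate ring of the closure of \<open>D\<close>.\<close>

definition alg_indep :: "'a set \<Rightarrow> 'i set \<Rightarrow> ('i \<Rightarrow> 'a \<Rightarrow> complex) \<Rightarrow> bool" where
  "alg_indep D I g \<longleftrightarrow>
     (\<forall>p. vars p \<subseteq> I \<longrightarrow> (\<forall>x\<in>D. peval p (\<lambda>i. g i x) = 0) \<longrightarrow> p = 0)"

lemma alg_indepD:
  "alg_indep D I g \<Longrightarrow> vars p \<subseteq> I \<Longrightarrow> (\<And>x. x \<in> D \<Longrightarrow> peval p (\<lambda>i. g i x) = 0) \<Longrightarrow> p = 0"
  by (auto simp: alg_indep_def)

lemma alg_indep_empty:
  assumes "D \<noteq> {}" shows "alg_indep D {} g"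
  unfolding alg_indep_def
proof (intro allI impI)
  fix p :: "'b cpoly" assume p: "vars p \<subseteq> {}" "\<forall>x\<in>D. peval p (\<lambda>i. g i x) = 0"
  obtain c where c: "p = Const c" using vars_empty_imp_Const[of p] p(1) by auto
  with p(2) assms have "c = 0" by auto
  then show "p = 0" using c by (simp add: Const_def)
qed

text \<open>A function may be adjoined to an independent family as soon as the relations of the enlarged
  family are closed under the partial derivative in the new variable: differentiating lowers the
  degree in this variable until it no longer occurs. It disappears only when its degree is
  zero because the characteristic is zero.\<close>

lemma alg_indep_insert:
  assumes I: "alg_indep D I g"
    and cl: "\<And>p. vars p \<subseteq> insert j I \<Longrightarrow> (\<And>x. x \<in> D \<Longrightarrow> peval p (\<lambda>i. g i x) = 0) \<Longrightarrow>
      (\<And>x. x \<in> D \<Longrightarrow> peval (pd j p) (\<lambda>i. g i x) = 0)"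
  shows "alg_indep D (insert j I) g"
proof -
  have "p = 0" if "\<And>e. e \<in> Poly_Mapping.keys p \<Longrightarrow> Poly_Mapping.lookup e j \<le> d"
    "vars p \<subseteq> insert j I" "\<And>x. x \<in> D \<Longrightarrow> peval p (\<lambda>i. g i x) = 0" for d p
    using that
  proof (induction d arbitrary: p)
    case 0
    then have "j \<notin> vars p" by (auto simp: vars_def in_keys_iff)
    with 0 have "vars p \<subseteq> I" by auto
    then show ?case using I 0(3) by (rule_tac alg_indepD)
  next
    case (Suc d)
    have "pd j p = 0"
    proof (rule Suc.IH)
      fix e assume "e \<in> Poly_Mapping.keys (pd j p)"
      from Suc.prems(1)[OF keys_pd_subset[OF this]] show "Poly_Mapping.lookup e j \<le> d"
        by (simp add: lookup_add)
    next
      show "vars (pd j p) \<subseteq> insert j I" by (rule subset_trans[OF vars_pd Suc.prems(2)])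
    qed (rule cl[OF Suc.prems(2,3)])
    from pd_eq_0_imp_not_in_vars[OF this] Suc.prems(2) have "vars p \<subseteq> I" by auto
    then show ?case using I Suc.prems(3) by (rule_tac alg_indepD)
  qed
  moreover have "\<exists>d. \<forall>e\<in>Poly_Mapping.keys p. Poly_Mapping.lookup e j \<le> d" for p :: "'b cpoly"
    by (rule exI[of _ "Max ((\<lambda>e. Poly_Mapping.lookup e j) ` Poly_Mapping.keys p)"]) auto
  ultimately show ?thesis unfolding alg_indep_def by metis
qed

text \<open>A function algebraic over an independent family thus satisfies a separable relation, the starting
  point of every use of implicit differentiation below.\<close>

lemma ex_relation_pd_nonzero:
  assumes "alg_indep D I g" "\<not> alg_indep D (insert j I) g"
  obtains p x where "vars p \<subseteq> insert j I" "\<And>x. x \<in> D \<Longrightarrow> peval p (\<lambda>i. g i x) = 0"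
    "x \<in> D" "peval (pd j p) (\<lambda>i. g i x) \<noteq> 0"
  using alg_indep_insert[OF assms(1), of j] assms(2) by blast

lemma alg_indep_if_pd_closed:
  assumes "finite I" "D \<noteq> {}"
    and cl: "\<And>p i x. vars p \<subseteq> I \<Longrightarrow> (\<And>x. x \<in> D \<Longrightarrow> peval p (\<lambda>i. g i x) = 0) \<Longrightarrow>
      i \<in> I \<Longrightarrow> x \<in> D \<Longrightarrow> peval (pd i p) (\<lambda>i. g i x) = 0"
  shows "alg_indep D I g"
proof -
  have "alg_indep D J g" if "finite J" "J \<subseteq> I" for J
    using that
  proof (induction J)
    case empty
    then show ?case using assms(2) by (simp add: alg_indep_empty)
  next
    case (insert j J)
    then show ?case by (intro alg_indep_insert[of _ J] cl) auto
  qed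
  then show ?thesis using assms(1) by blast
qed

text \<open>A nonzero polynomial is a nonzero function because the coordinates are independent: their
  relations are closed under all partial derivatives.\<close>

lemma ex_peval_nonzero:
  fixes p :: "'i::finite cpoly"
  assumes "p \<noteq> 0" shows "\<exists>x::complex^'i. peval p (($) x) \<noteq> 0"
proof (rule ccontr)
  assume *: "\<not> ?thesis"
  have "alg_indep UNIV UNIV (\<lambda>i (x::complex^'i). x $ i)"
  proof (rule alg_indep_if_pd_closed)
    fix p :: "'i cpoly" and i and x :: "complex^'i"
    assume p: "\<And>x. x \<in> UNIV \<Longrightarrow> peval p (\<lambda>i. (x::complex^'i) $ i) = 0"
    have "((\<lambda>x. peval p (\<lambda>i. x $ i)) has_derivative
      (\<lambda>v. \<Sum>i\<in>UNIV. peval (pd i p) (\<lambda>i. x $ i) * v $ i)) (at x)"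
      by (rule peval_has_derivative) (auto intro: bounded_linear_imp_has_derivative)
    moreover have "((\<lambda>x::complex^'i. peval p (\<lambda>i. x $ i)) has_derivative (\<lambda>v. 0)) (at x)"
      using p by simp
    ultimately have "(\<lambda>v. \<Sum>i\<in>UNIV. peval (pd i p) (\<lambda>i. x $ i) * v $ i) = (\<lambda>v. 0)"
      by (rule has_derivative_unique)
    from fun_cong[OF this, of "axis i 1"]
    show "peval (pd i p) (\<lambda>i. x $ i) = 0"
      by (simp add: axis_def if_distrib cong: if_cong)
  qed auto
  from alg_indepD[OF this, of p] * assms show False by simp
qed

text \<open>Reindexing by an injection lets families over different index types be joined over their sum
  type.\<close>

lemma alg_indep_reindex:
  fixes j :: "'k \<Rightarrow> 'i"
  assumes j: "inj j" and ind: "alg_indep D K (\<lambda>k. g (j k))"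
  shows "alg_indep D (j ` K) g"
  unfolding alg_indep_def
proof (intro allI impI)
  fix p :: "'i cpoly" assume p: "vars p \<subseteq> j ` K" "\<forall>x\<in>D. peval p (\<lambda>i. g i x) = 0"
  let ?m = "\<lambda>e. Poly_Mapping.map_key j e"
  have lm: "Poly_Mapping.lookup (?m e) k = Poly_Mapping.lookup e (j k)" for e :: "'i \<Rightarrow>\<^sub>0 nat" and k
    using fun_cong[OF map_key.rep_eq[OF j, of e], of k] by simp
  have ke: "Poly_Mapping.keys e \<subseteq> j ` K" if "e \<in> Poly_Mapping.keys p" for e
    using p(1) that by (auto simp: vars_def)
  have inj: "e = e'" if "e \<in> Poly_Mapping.keys p" "e' \<in> Poly_Mapping.keys p" "?m e = ?m e'" for e e'
  proof (rule poly_mapping_eqI)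
    fix i show "Poly_Mapping.lookup e i = Poly_Mapping.lookup e' i"
    proof (cases "i \<in> j ` K")
      case True
      then show ?thesis using that(3) lm by (metis imageE)
    next
      case False
      then have "i \<notin> Poly_Mapping.keys e" "i \<notin> Poly_Mapping.keys e'" using ke that by blast+
      then show ?thesis by (simp add: in_keys_iff)
    qed
  qed
  define q where "q = (\<Sum>e\<in>Poly_Mapping.keys p. Poly_Mapping.single (?m e) (Poly_Mapping.lookup p e))"
  have mono: "pmonom (?m e) (\<lambda>k. y (j k)) = pmonom e y" if "e \<in> Poly_Mapping.keys p" for e y
  proof -
    have k: "j ` Poly_Mapping.keys (?m e) = Poly_Mapping.keys e"
      using ke[OF that] by (auto simp: in_keys_iff lm)
    have "pmonom e y = (\<Prod>i\<in>j ` Poly_Mapping.keys (?m e). y i ^ Poly_Mapping.lookup e i)"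
      by (simp add: pmonom_def k)
    also have "\<dots> = pmonom (?m e) (\<lambda>k. y (j k))"
      using j by (subst prod.reindex) (auto simp: pmonom_def lm intro: inj_on_subset)
    finally show ?thesis by simp
  qed
  have "q = 0"
  proof (rule alg_indepD[OF ind])
    show "vars q \<subseteq> K"
    proof
      fix k assume "k \<in> vars q"
      then obtain e' where "e' \<in> Poly_Mapping.keys q" "k \<in> Poly_Mapping.keys e'" by (auto simp: vars_def)
      then obtain e where e: "e \<in> Poly_Mapping.keys p" "k \<in> Poly_Mapping.keys (?m e)"
        using keys_sum_single_subset[of "Poly_Mapping.keys p" ?m] unfolding q_def by fastforce
      then have "j k \<in> j ` K" using ke[of e] by (auto simp: in_keys_iff lm)
      then show "k \<in> K" using j by (auto dest: injD)
    qed
    fix x assume "x \<in> D"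
    then have "0 = peval p (\<lambda>i. g i x)" using p by simp
    also have "\<dots> = peval q (\<lambda>k. g (j k) x)"
      by (simp add: q_def peval_sum peval_def[of p] mono[of _ "\<lambda>i. g i x"] cong: sum.cong)
    finally show "peval q (\<lambda>k. g (j k) x) = 0" by simp
  qed
  have "Poly_Mapping.lookup p e = 0" for e
  proof (rule ccontr)
    assume "Poly_Mapping.lookup p e \<noteq> 0"
    then have e: "e \<in> Poly_Mapping.keys p" by (simp add: in_keys_iff)
    have "Poly_Mapping.lookup q (?m e) = (\<Sum>d\<in>Poly_Mapping.keys p. if d = e then Poly_Mapping.lookup p d else 0)"
      unfolding q_def lookup_sum lookup_single when_def
      by (intro sum.cong refl) (use inj e in auto)
    then show False using e \<open>q = 0\<close> by (simp add: in_keys_iff)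
  qed
  then show "p = 0" by (intro poly_mapping_eqI) simp
qed

section \<open>Rank of matrices over a field\<close>

text \<open>Expand the rows in a basis of the row space; the vectors of coefficients then span the columns.\<close>

lemma dim_columns_le_dim_rows:
  fixes A :: "'a::field^'n^'m"
  shows "vec.dim (columns A) \<le> vec.dim (rows A)"
proof -
  obtain b where b: "b \<subseteq> rows A" "vec.independent b" "rows A \<subseteq> vec.span b" "card b = vec.dim (rows A)"
    using vec.basis_exists by blast
  have fin: "finite b" using b(2) vec.finiteI_independent by blast
  have "\<exists>c. row i A = (\<Sum>v\<in>b. c v *s v)" for i
  proof -
    have "row i A \<in> vec.span b" using b(3) by (auto simp: rows_def)
    then show ?thesis by (auto simp: vec.span_finite[OF fin])
  qed
  then obtain c where c: "\<And>i. row i A = (\<Sum>v\<in>b. c i v *s v)" by metis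
  have "columns A \<subseteq> vec.span ((\<lambda>v. \<chi> i. c i v) ` b)"
  proof
    fix w assume "w \<in> columns A"
    then obtain j where w: "w = column j A" by (auto simp: columns_def)
    have "w = (\<Sum>v\<in>b. v $ j *s (\<chi> i. c i v))"
    proof (rule vec_eq_iff[THEN iffD2], rule allI)
      fix i
      have "w $ i = row i A $ j" by (simp add: w row_def column_def)
      also have "\<dots> = (\<Sum>v\<in>b. v $ j *s (\<chi> i. c i v)) $ i" by (simp add: c mult.commute)
      finally show "w $ i = (\<Sum>v\<in>b. v $ j *s (\<chi> i. c i v)) $ i" .
    qed
    then show "w \<in> vec.span ((\<lambda>v. \<chi> i. c i v) ` b)"
      by (simp only:) (intro vec.span_sum vec.span_scale vec.span_base imageI)
  qed
  then have "vec.dim (columns A) \<le> card ((\<lambda>v. \<chi> i. c i v) ` b)"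
    by (rule vec.dim_le_card) (simp add: fin)
  also have "\<dots> \<le> vec.dim (rows A)" using card_image_le[OF fin] b(4) by metis
  finally show ?thesis .
qed

lemma rank_eq_dim_columns:
  fixes A :: "'a::field^'n^'m"
  shows "rank A = vec.dim (columns A)"
  unfolding row_rank_def_gen
  using dim_columns_le_dim_rows[of A] dim_columns_le_dim_rows[of "transpose A"] by simp

lemma rank_transpose_field:
  fixes A :: "'a::field^'n^'m"
  shows "rank (transpose A) = rank A"
  using rank_eq_dim_columns[of A] by (simp add: row_rank_def_gen)

lemma rank_eq_dim_range:
  fixes A :: "'a::field^'n^'m"
  shows "rank A = vec.dim (range ((*v) A))"
proof (rule antisym)
  have "column i A \<in> range ((*v) A)" for i
  proof
    show "column i A = A *v axis i 1"
      by (simp add: vec_eq_iff column_def matrix_vector_mult_def axis_def if_distrib cong: if_cong)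
  qed simp
  then have "columns A \<subseteq> range ((*v) A)" by (auto simp: columns_def)
  then show "rank A \<le> vec.dim (range ((*v) A))"
    unfolding rank_eq_dim_columns by (rule vec.dim_subset)
  have "range ((*v) A) \<subseteq> vec.span (columns A)"
    using matrix_vector_mult_in_columnspace_gen by blast
  then show "vec.dim (range ((*v) A)) \<le> rank A"
    unfolding rank_eq_dim_columns by (rule vec.dim_mono)
qed

text \<open>The columns of \<open>A\<close> with index in \<open>S\<close> are linearly independent, stated as injectivity on
  the coordinate subspace of \<open>S\<close>.\<close>

definition indep_columns :: "'a::field^'n^'m \<Rightarrow> 'n set \<Rightarrow> bool" where
  "indep_columns A S \<longleftrightarrow> (\<forall>w. (\<forall>j. j \<notin> S \<longrightarrow> w $ j = 0) \<longrightarrow> A *v w = 0 \<longrightarrow> w = 0)"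

lemma indep_columnsD:
  "indep_columns A S \<Longrightarrow> (\<And>j. j \<notin> S \<Longrightarrow> w $ j = 0) \<Longrightarrow> A *v w = 0 \<Longrightarrow> w = 0"
  by (auto simp: indep_columns_def)

lemma ex_indep_columns:
  fixes A :: "'a::field^'n^'m"
  obtains S where "card S = rank A" "indep_columns A S"
proof -
  obtain b where b: "b \<subseteq> columns A" "vec.independent b" "card b = vec.dim (columns A)"
    by (rule vec.basis_exists[of "columns A"]) (rule that)
  have fin: "finite b" using b(2) vec.finiteI_independent by blast
  have "\<forall>v\<in>b. \<exists>i. column i A = v" using b(1) by (auto simp: columns_def)
  then obtain k where k: "\<And>v. v \<in> b \<Longrightarrow> column (k v) A = v" by metis
  have inj: "inj_on k b" by (metis inj_onI k)
  have "indep_columns A (k ` b)"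
    unfolding indep_columns_def
  proof (intro allI impI)
    fix w :: "'a^'n" assume w: "\<forall>j. j \<notin> k ` b \<longrightarrow> w $ j = 0" "A *v w = 0"
    have "0 = (\<Sum>i\<in>UNIV. w $ i *s column i A)" using w(2) by (simp add: matrix_mult_sum)
    also have "\<dots> = (\<Sum>i\<in>k ` b. w $ i *s column i A)"
      by (rule sum.mono_neutral_right) (use w(1) in auto)
    also have "\<dots> = (\<Sum>v\<in>b. w $ k v *s v)"
      by (simp add: sum.reindex[OF inj] k)
    finally have sum0: "(\<Sum>v\<in>b. w $ k v *s v) = 0" by simp
    have ind: "(\<Sum>v\<in>b. c v *s v) = 0 \<Longrightarrow> \<forall>v\<in>b. c v = 0" for c
      using b(2) unfolding vec.independent_explicit by blast
    have "\<forall>v\<in>b. w $ k v = 0" by (rule ind[OF sum0])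
    then have "w $ i = 0" for i using w(1) by (cases "i \<in> k ` b") auto
    then show "w = 0" by (simp add: vec_eq_iff)
  qed
  moreover have "card (k ` b) = rank A"
    by (simp add: card_image inj b(3) rank_eq_dim_columns)
  ultimately show thesis using that by blast
qed

lemma card_le_rank:
  fixes A :: "'a::field^'n^'m"
  assumes "indep_columns A S" shows "card S \<le> rank A"
proof -
  let ?W = "{x::'a^'n. \<forall>i. i \<notin> S \<longrightarrow> x $ i = 0}"
  have sub: "vec.subspace ?W" by (auto simp: vec.subspace_def)
  have inj: "inj_on ((*v) A) (vec.span ?W)"
    unfolding vec.span_eq_iff[THEN iffD2, OF sub]
  proof (rule inj_onI)
    fix x y assume *: "x \<in> ?W" "y \<in> ?W" "A *v x = A *v y"
    then have "A *v (x - y) = 0" by (simp add: matrix_vector_mult_diff_distrib)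
    with indep_columnsD[OF assms, of "x - y"] * show "x = y" by simp
  qed
  have "card S = vec.dim ?W" by (simp add: dim_substandard_cart)
  also have "\<dots> = vec.dim ((*v) A ` ?W)"
    by (rule vec.dim_image_eq[symmetric, OF _ inj]) simp
  also have "\<dots> \<le> rank A" unfolding rank_eq_dim_range by (rule vec.dim_subset) auto
  finally show ?thesis .
qed

lemma rank_le_card_rows:
  fixes A :: "'a::field^'n^'m"
  assumes "\<And>i j. i \<notin> R \<Longrightarrow> A $ i $ j = 0" shows "rank A \<le> card R"
proof -
  obtain S where S: "card S = rank (transpose A)" "indep_columns (transpose A) S"
    by (rule ex_indep_columns)
  have "S \<subseteq> R"
  proof
    fix i assume i: "i \<in> S"
    show "i \<in> R"
    proof (rule ccontr)
      assume "i \<notin> R"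
      then have "transpose A *v axis i 1 = 0"
        using assms by (auto simp: matrix_vector_mult_def transpose_def axis_def vec_eq_iff intro!: sum.neutral)
      then have "axis i 1 = (0 :: 'a^'m)"
        by (rule indep_columnsD[OF S(2), rotated]) (use i in \<open>auto simp: axis_def\<close>)
      then show False by (simp add: axis_eq_0_iff)
    qed
  qed
  then have "card S \<le> card R" by (intro card_mono) auto
  then show ?thesis using S(1) by (simp add: rank_transpose_field)
qed

lemma indep_columns_mono: "indep_columns A S \<Longrightarrow> T \<subseteq> S \<Longrightarrow> indep_columns A T"
  unfolding indep_columns_def by blast

section \<open>Regular functions\<close>

abbreviation nonvanishing :: "'m cpoly \<Rightarrow> (complex^'m) set" where
  "nonvanishing h \<equiv> {x. peval h (($) x) \<noteq> 0}"

text \<open>The elements of the polynomial ring localised at \<open>h\<close>, as functions on the complement of the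
  hypersurface \<open>h = 0\<close>; their values on the hypersurface are arbitrary.\<close>

definition regular :: "'m cpoly \<Rightarrow> (complex^'m \<Rightarrow> complex) \<Rightarrow> bool" where
  "regular h F \<longleftrightarrow> (\<exists>a N. \<forall>x\<in>nonvanishing h. F x = peval a (($) x) / peval h (($) x) ^ N)"

lemma regularI: "(\<And>x. peval h (($) x) \<noteq> 0 \<Longrightarrow> F x = peval a (($) x) / peval h (($) x) ^ N) \<Longrightarrow> regular h F"
  unfolding regular_def by blast

lemma regular_peval: "regular h (\<lambda>x. peval a (($) x))"
  by (rule regularI[of _ _ a 0]) simp

lemma regular_const: "regular h (\<lambda>x. c)"
  by (rule regularI[of _ _ "Const c" 0]) simp

lemma regular_component: "regular h (\<lambda>x. x $ i)"
  by (rule regularI[of _ _ "Var i" 0]) simp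

lemma regular_add:
  assumes "regular h F" "regular h G" shows "regular h (\<lambda>x. F x + G x)"
proof -
  from assms(1) obtain a N where a: "\<forall>x\<in>nonvanishing h. F x = peval a (($) x) / peval h (($) x) ^ N"
    unfolding regular_def by blast
  from assms(2) obtain b M where b: "\<forall>x\<in>nonvanishing h. G x = peval b (($) x) / peval h (($) x) ^ M"
    unfolding regular_def by blast
  show ?thesis
    by (rule regularI[of _ _ "a * h ^ M + b * h ^ N" "N + M"])
      (simp add: a b peval_add peval_mult peval_power field_simps power_add)
qed

lemma regular_mult:
  assumes "regular h F" "regular h G" shows "regular h (\<lambda>x. F x * G x)"
proof -
  from assms(1) obtain a N where a: "\<forall>x\<in>nonvanishing h. F x = peval a (($) x) / peval h (($) x) ^ N"
    unfolding regular_def by blast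
  from assms(2) obtain b M where b: "\<forall>x\<in>nonvanishing h. G x = peval b (($) x) / peval h (($) x) ^ M"
    unfolding regular_def by blast
  show ?thesis
    by (rule regularI[of _ _ "a * b" "N + M"]) (simp add: a b peval_mult power_add)
qed

lemma regular_sum: "(\<And>i. i \<in> I \<Longrightarrow> regular h (F i)) \<Longrightarrow> regular h (\<lambda>x. \<Sum>i\<in>I. F i x)"
  by (induction I rule: infinite_finite_induct) (auto intro: regular_add regular_const)

lemma regular_prod: "(\<And>i. i \<in> I \<Longrightarrow> regular h (F i)) \<Longrightarrow> regular h (\<lambda>x. \<Prod>i\<in>I. F i x)"
  by (induction I rule: infinite_finite_induct) (auto intro: regular_mult regular_const)

lemma regular_power: "regular h F \<Longrightarrow> regular h (\<lambda>x. F x ^ n)"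
  by (induction n) (auto intro: regular_mult regular_const)

lemma regular_compose:
  assumes "\<And>i. i \<in> vars p \<Longrightarrow> regular h (g i)" shows "regular h (\<lambda>x. peval p (\<lambda>i. g i x))"
  unfolding peval_def pmonom_def
  by (intro regular_sum regular_mult regular_const regular_prod regular_power assms)
    (auto simp: vars_def)

lemma regular_det:
  fixes M :: "complex^'m \<Rightarrow> complex^'c^'c"
  assumes "\<And>i j. regular h (\<lambda>x. M x $ i $ j)" shows "regular h (\<lambda>x. det (M x))"
  unfolding det_def by (intro regular_sum regular_mult regular_const regular_prod assms)

text \<open>The affine subspace through \<open>p\<close> spanned by the coordinate directions in \<open>S\<close>.\<close>

definition slice :: "'m set \<Rightarrow> complex^'m \<Rightarrow> (complex^'m) set" where
  "slice S p = {x. \<forall>j. j \<notin> S \<longrightarrow> x $ j = p $ j}"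

lemma slice_UNIV [simp]: "slice UNIV p = UNIV"
  by (simp add: slice_def)

lemma slice_base [simp]: "p \<in> slice S p"
  by (simp add: slice_def)

text \<open>A slice is irreducible: two of its points are joined by a line, on which a product of nonzero
  polynomials in one variable is nonzero.\<close>

lemma regular_mult_eq_0:
  assumes F: "regular h F" and G: "regular h G"
    and FG: "\<And>x. x \<in> slice S p \<inter> nonvanishing h \<Longrightarrow> F x * G x = 0"
    and y: "y \<in> slice S p \<inter> nonvanishing h" "G y \<noteq> 0"
    and x: "x \<in> slice S p \<inter> nonvanishing h"
  shows "F x = 0"
proof (rule ccontr)
  assume Fx: "F x \<noteq> 0"
  from F obtain a N where a: "\<forall>x\<in>nonvanishing h. F x = peval a (($) x) / peval h (($) x) ^ N"
    unfolding regular_def by blast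
  from G obtain b M where b: "\<forall>x\<in>nonvanishing h. G x = peval b (($) x) / peval h (($) x) ^ M"
    unfolding regular_def by blast
  define l where "l t = (\<chi> i. x $ i + t * (y $ i - x $ i))" for t
  have l: "($) (l t) = (\<lambda>i. x $ i + t * (y $ i - x $ i))" for t
    by (auto simp: l_def)
  have l01: "l 0 = x" "l 1 = y" by (auto simp: l_def vec_eq_iff)
  have lW: "l t \<in> slice S p" for t using x y by (auto simp: l_def slice_def)
  obtain u where u: "\<And>t. peval a (($) (l t)) = poly u t"
    using ex_poly_on_line[of a "($) x" "\<lambda>i. y $ i - x $ i"] by (auto simp: l)
  obtain v where v: "\<And>t. peval b (($) (l t)) = poly v t"
    using ex_poly_on_line[of b "($) x" "\<lambda>i. y $ i - x $ i"] by (auto simp: l)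
  obtain w where w: "\<And>t. peval h (($) (l t)) = poly w t"
    using ex_poly_on_line[of h "($) x" "\<lambda>i. y $ i - x $ i"] by (auto simp: l)
  have "poly u 0 \<noteq> 0" "poly v 1 \<noteq> 0" "poly w 0 \<noteq> 0"
    unfolding u[symmetric] v[symmetric] w[symmetric] l01 using x y Fx a b by auto
  then have "u * v * w \<noteq> 0" by auto
  then have "finite {t. poly (u * v * w) t = 0}" by (rule poly_roots_finite)
  then obtain t where "poly (u * v * w) t \<noteq> 0"
    using ex_new_if_finite[OF infinite_UNIV_char_0] by blast
  then have t: "poly u t \<noteq> 0" "poly v t \<noteq> 0" "poly w t \<noteq> 0" by auto
  then have "l t \<in> slice S p \<inter> nonvanishing h" using lW w by auto
  from FG[OF this] show False using a b t u v w by simp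
qed

lemma regular_nonzero_mult:
  assumes "regular h F" "regular h G"
    and "x \<in> slice S p \<inter> nonvanishing h" "F x \<noteq> 0"
    and "y \<in> slice S p \<inter> nonvanishing h" "G y \<noteq> 0"
  obtains z where "z \<in> slice S p \<inter> nonvanishing h" "F z \<noteq> 0" "G z \<noteq> 0"
  using regular_mult_eq_0[OF assms(1,2) _ assms(5,6,3)] assms(4) by fastforce

lemma regular_nonzero_prod:
  assumes "finite I" "\<And>i. i \<in> I \<Longrightarrow> regular h (F i)"
    and "\<And>i. i \<in> I \<Longrightarrow> \<exists>x\<in>slice S p \<inter> nonvanishing h. F i x \<noteq> 0"
    and "slice S p \<inter> nonvanishing h \<noteq> {}"
  obtains z where "z \<in> slice S p \<inter> nonvanishing h" "\<And>i. i \<in> I \<Longrightarrow> F i z \<noteq> 0"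
proof -
  have "\<exists>z\<in>slice S p \<inter> nonvanishing h. (\<Prod>i\<in>I. F i z) \<noteq> 0"
    using assms(1-3)
  proof (induction I)
    case empty
    then show ?case using assms(4) by auto
  next
    case (insert i I)
    then obtain x where x: "x \<in> slice S p \<inter> nonvanishing h" "(\<Prod>i\<in>I. F i x) \<noteq> 0" by auto
    obtain y where y: "y \<in> slice S p \<inter> nonvanishing h" "F i y \<noteq> 0" using insert.prems by blast
    have "regular h (F i)" "regular h (\<lambda>x. \<Prod>i\<in>I. F i x)"
      using insert.prems by (auto intro: regular_prod)
    from regular_nonzero_mult[OF this y x]
    obtain z where "z \<in> slice S p \<inter> nonvanishing h" "F i z \<noteq> 0" "(\<Prod>i\<in>I. F i z) \<noteq> 0" .
    then show ?case using insert by (intro bexI[of _ z]) auto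
  qed
  then show thesis using assms(1) that by auto
qed

text \<open>Linear independence of columns is an open condition, witnessed by the nonvanishing of one regular
  function, a determinant.\<close>

lemma indep_columns_open:
  fixes B :: "complex^'m \<Rightarrow> complex^'c^'n"
  assumes B: "\<And>i j. regular h (\<lambda>x. B x $ i $ j)" and p: "indep_columns (B p) S"
  obtains \<delta> where "regular h \<delta>" "\<delta> p \<noteq> 0" "\<And>x. \<delta> x \<noteq> 0 \<Longrightarrow> indep_columns (B x) S"
proof -
  let ?W = "{x::complex^'c. \<forall>i. i \<notin> S \<longrightarrow> x $ i = 0}"
  have sub: "vec.subspace ?W" by (auto simp: vec.subspace_def)
  have "inj_on ((*v) (B p)) ?W"
  proof (rule inj_onI)
    fix x y assume *: "x \<in> ?W" "y \<in> ?W" "B p *v x = B p *v y"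
    then have "B p *v (x - y) = 0" by (simp add: matrix_vector_mult_diff_distrib)
    with indep_columnsD[OF p, of "x - y"] * show "x = y" by simp
  qed
  from vec.linear_exists_left_inverse_on[OF matrix_vector_mul_linear_gen sub this]
  obtain g where g: "Vector_Spaces.linear (*s) (*s) g" "\<And>v. v \<in> ?W \<Longrightarrow> g (B p *v v) = v"
    by auto
  define U where "U = matrix g"
  have U: "U *v (B p *v v) = v" if "v \<in> ?W" for v
    using g(2)[OF that] matrix_works[OF g(1)] by (simp add: U_def)
  \<comment> \<open>\<open>U\<close> inverts \<open>B p\<close> on the coordinate subspace; completing \<open>U ** B x\<close> by unit vectors in the
    remaining columns gives a square matrix that is the identity at \<open>p\<close>.\<close>
  define M where "M x = (\<chi> i j. if j \<in> S then (U ** B x) $ i $ j else if i = j then 1 else 0)" for x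
  have Mmult: "M x *v w = U *v (B x *v w)" if "w \<in> ?W" for x w
  proof -
    have "M x *v w = (U ** B x) *v w"
      using that by (auto simp: M_def matrix_vector_mult_def vec_eq_iff intro!: sum.cong)
    then show ?thesis by (simp add: matrix_vector_mul_assoc)
  qed
  have "M p = mat 1"
  proof -
    have "(U ** B p) $ i $ j = (if i = j then 1 else 0)" if "j \<in> S" for i j
    proof -
      have "(U ** B p) *v axis j 1 = axis j 1"
        using U[of "axis j 1"] that by (auto simp: matrix_vector_mul_assoc axis_def)
      then have "((U ** B p) *v axis j 1) $ i = axis j 1 $ i" by simp
      then show ?thesis
        by (auto simp: matrix_vector_mult_def axis_def if_distrib cong: if_cong)
    qed
    then show ?thesis by (auto simp: M_def mat_def vec_eq_iff)
  qed
  then have 1: "det (M p) \<noteq> 0" by simp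
  have 2: "regular h (\<lambda>x. det (M x))"
  proof (rule regular_det)
    fix i j show "regular h (\<lambda>x. M x $ i $ j)"
      by (cases "j \<in> S")
        (auto simp: M_def matrix_matrix_mult_def intro!: regular_sum regular_mult regular_const B)
  qed
  have 3: "indep_columns (B x) S" if "det (M x) \<noteq> 0" for x
    unfolding indep_columns_def
  proof (intro allI impI)
    fix w assume w: "\<forall>j. j \<notin> S \<longrightarrow> w $ j = 0" "B x *v w = 0"
    then have "M x *v w = 0" using Mmult by simp
    moreover have "invertible (M x)" using that by (simp add: invertible_det_nz)
    ultimately show "w = 0"
      using matrix_left_invertible_ker[of "M x"] invertible_left_inverse by blast
  qed
  show thesis by (rule that[OF 2 1 3])
qed

section \<open>Counting: too many regular functions are algebraically dependent\<close>

text \<open>Bounding the degree in each variable separately, rather than the total degree, makes the number of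
  monomials a power.\<close>

definition exponents :: "'i set \<Rightarrow> nat \<Rightarrow> ('i \<Rightarrow>\<^sub>0 nat) set" where
  "exponents S d = {e. Poly_Mapping.keys e \<subseteq> S \<and> (\<forall>i. Poly_Mapping.lookup e i \<le> d)}"

lemma bij_betw_exponents:
  assumes "finite S"
  shows "bij_betw (\<lambda>e. restrict (Poly_Mapping.lookup e) S) (exponents S d) (S \<rightarrow>\<^sub>E {..d})"
proof (rule bij_betwI')
  fix e e' assume *: "e \<in> exponents S d" "e' \<in> exponents S d"
  show "(restrict (Poly_Mapping.lookup e) S = restrict (Poly_Mapping.lookup e') S) = (e = e')"
  proof
    assume r: "restrict (Poly_Mapping.lookup e) S = restrict (Poly_Mapping.lookup e') S"
    show "e = e'"
    proof (rule poly_mapping_eqI)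
      fix i show "Poly_Mapping.lookup e i = Poly_Mapping.lookup e' i"
      proof (cases "i \<in> S")
        case True
        then show ?thesis using fun_cong[OF r, of i] by simp
      next
        case False
        then have "i \<notin> Poly_Mapping.keys e" "i \<notin> Poly_Mapping.keys e'"
          using * by (auto simp: exponents_def)
        then show ?thesis by (simp add: in_keys_iff)
      qed
    qed
  qed simp
next
  fix e assume "e \<in> exponents S d"
  then show "restrict (Poly_Mapping.lookup e) S \<in> S \<rightarrow>\<^sub>E {..d}" by (auto simp: exponents_def)
next
  fix f assume f: "f \<in> S \<rightarrow>\<^sub>E {..d}"
  define g where "g i = (if i \<in> S then f i else 0)" for i
  define e where "e = Abs_poly_mapping g"
  have "finite {i. g i \<noteq> 0}" by (rule finite_subset[OF _ assms]) (auto simp: g_def)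
  then have e: "Poly_Mapping.lookup e = g" by (simp add: e_def)
  have "e \<in> exponents S d" using f by (auto simp: exponents_def e in_keys_iff g_def)
  moreover have "f = restrict (Poly_Mapping.lookup e) S"
    using f by (auto simp: e g_def fun_eq_iff)
  ultimately show "\<exists>e\<in>exponents S d. f = restrict (Poly_Mapping.lookup e) S" by blast
qed

lemma finite_exponents: "finite S \<Longrightarrow> finite (exponents S d)"
  and card_exponents: "finite S \<Longrightarrow> card (exponents S d) = (d + 1) ^ card S"
  using bij_betw_finite[OF bij_betw_exponents[of S d]] bij_betw_same_card[OF bij_betw_exponents[of S d]]
  by (auto simp: card_PiE finite_PiE)

lemma exponents_mono: "d \<le> d' \<Longrightarrow> exponents S d \<subseteq> exponents S d'"
  by (auto simp: exponents_def intro: order_trans)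

lemma keys_mult_exponents:
  assumes "Poly_Mapping.keys p \<subseteq> exponents S d" "Poly_Mapping.keys q \<subseteq> exponents S d'"
  shows "Poly_Mapping.keys (p * q) \<subseteq> exponents S (d + d')"
proof
  fix e assume "e \<in> Poly_Mapping.keys (p * q)"
  then obtain a b where "e = a + b" "a \<in> Poly_Mapping.keys p" "b \<in> Poly_Mapping.keys q"
    using keys_mult[of p q] by blast
  then have "a \<in> exponents S d" "b \<in> exponents S d'" "e = a + b" using assms by auto
  then show "e \<in> exponents S (d + d')"
    using Poly_Mapping.keys_add[of a b] by (auto simp: exponents_def lookup_add add_mono)
qed

lemma keys_Const_exponents: "Poly_Mapping.keys (Const c) \<subseteq> exponents S d"
  by (auto simp: Const_def exponents_def)

lemma keys_power_exponents:
  "Poly_Mapping.keys p \<subseteq> exponents S d \<Longrightarrow> Poly_Mapping.keys (p ^ n) \<subseteq> exponents S (n * d)"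
proof (induction n)
  case 0
  then show ?case using keys_Const_exponents[of 1] by (simp add: Const_def)
next
  case (Suc n)
  then show ?case using keys_mult_exponents[of p S d "p ^ n" "n * d"] by simp
qed

lemma keys_prod_exponents:
  "finite I \<Longrightarrow> (\<And>i. i \<in> I \<Longrightarrow> Poly_Mapping.keys (p i) \<subseteq> exponents S d) \<Longrightarrow>
     Poly_Mapping.keys (\<Prod>i\<in>I. p i) \<subseteq> exponents S (card I * d)"
proof (induction I rule: finite_induct)
  case empty
  then show ?case using keys_Const_exponents[of 1] by (simp add: Const_def)
next
  case (insert i I)
  then show ?case using keys_mult_exponents[of "p i" S d "\<Prod>i\<in>I. p i" "card I * d"] by simp
qed

text \<open>Substituting the fixed coordinates of a slice leaves a polynomial in the free variables, whose
  monomials are then counted.\<close>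

lemma ex_restrict_to_slice:
  "\<exists>q d. Poly_Mapping.keys q \<subseteq> exponents S d \<and> (\<forall>x\<in>slice S y. peval p (($) x) = peval q (($) x))"
proof (induction p rule: cpoly_induct)
  case (const c)
  then show ?case using keys_Const_exponents by metis
next
  case (var i)
  show ?case
  proof (cases "i \<in> S")
    case True
    then have "Poly_Mapping.keys (Var i) \<subseteq> exponents S 1"
      by (auto simp: Var_def exponents_def lookup_single when_def)
    then show ?thesis by metis
  next
    case False
    then have "\<forall>x\<in>slice S y. peval (Var i) (($) x) = peval (Const (y $ i)) (($) x)"
      by (auto simp: slice_def)
    then show ?thesis using keys_Const_exponents by metis
  qed
next
  case (add p q)
  then obtain p' d q' d' where
    *: "Poly_Mapping.keys p' \<subseteq> exponents S d" "\<forall>x\<in>slice S y. peval p (($) x) = peval p' (($) x)"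
       "Poly_Mapping.keys q' \<subseteq> exponents S d'" "\<forall>x\<in>slice S y. peval q (($) x) = peval q' (($) x)"
    by blast
  have "Poly_Mapping.keys (p' + q') \<subseteq> exponents S (max d d')"
    using * Poly_Mapping.keys_add[of p' q'] exponents_mono[of d "max d d'" S] exponents_mono[of d' "max d d'" S]
    by (meson Un_least max.cobounded1 max.cobounded2 subset_trans)
  with * show ?case by (intro exI[of _ "p' + q'"] exI[of _ "max d d'"]) (auto simp: peval_add)
next
  case (mult p q)
  then obtain p' d q' d' where
    *: "Poly_Mapping.keys p' \<subseteq> exponents S d" "\<forall>x\<in>slice S y. peval p (($) x) = peval p' (($) x)"
       "Poly_Mapping.keys q' \<subseteq> exponents S d'" "\<forall>x\<in>slice S y. peval q (($) x) = peval q' (($) x)"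
    by blast
  then show ?case using keys_mult_exponents[OF *(1,3)]
    by (intro exI[of _ "p' * q'"] exI[of _ "d + d'"]) (auto simp: peval_mult)
qed

text \<open>Gaussian elimination in a homogeneous linear system with more unknowns \<open>E\<close> than equations \<open>F\<close>.\<close>

lemma ex_nontrivial_solution:
  fixes M :: "'a \<Rightarrow> 'b \<Rightarrow> complex"
  assumes "finite F" "finite E" "card F < card E"
  shows "\<exists>c. (\<exists>e\<in>E. c e \<noteq> 0) \<and> (\<forall>f\<in>F. (\<Sum>e\<in>E. c e * M e f) = 0)"
  using assms
proof (induction F arbitrary: E M rule: finite_induct)
  case empty
  then have "E \<noteq> {}" by auto
  then show ?case by (intro exI[of _ "\<lambda>_. 1"]) auto
next
  case (insert f F)
  show ?case
  proof (cases "\<forall>e\<in>E. M e f = 0")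
    case True
    have "card F < card E" using insert by simp
    from insert.IH[OF insert.prems(1) this, of M] True show ?thesis by auto
  next
    case False
    then obtain e0 where e0: "e0 \<in> E" "M e0 f \<noteq> 0" by blast
    define M' where "M' e g = M e g - M e f / M e0 f * M e0 g" for e g
    have fE: "finite (E - {e0})" and c: "card F < card (E - {e0})" using insert e0 by auto
    obtain c where c: "\<exists>e\<in>E - {e0}. c e \<noteq> 0" "\<And>g. g \<in> F \<Longrightarrow> (\<Sum>e\<in>E - {e0}. c e * M' e g) = 0"
      using insert.IH[OF fE c, of M'] by blast
    define s where "s = (\<Sum>e\<in>E - {e0}. c e * M e f) / M e0 f"
    define c' where "c' = c(e0 := - s)"
    have sum: "(\<Sum>e\<in>E. c' e * M e g) = (\<Sum>e\<in>E - {e0}. c e * M' e g)" for g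
    proof -
      have "(\<Sum>e\<in>E. c' e * M e g) = - s * M e0 g + (\<Sum>e\<in>E - {e0}. c' e * M e g)"
        using sum.remove[OF insert.prems(1) e0(1), of "\<lambda>e. c' e * M e g"] by (simp add: c'_def)
      also have "(\<Sum>e\<in>E - {e0}. c' e * M e g) = (\<Sum>e\<in>E - {e0}. c e * M e g)"
        by (rule sum.cong) (auto simp: c'_def)
      also have "- s * M e0 g + \<dots> = (\<Sum>e\<in>E - {e0}. c e * M' e g)"
        by (simp add: s_def M'_def algebra_simps sum_subtractf sum_distrib_left sum_distrib_right
            sum_divide_distrib)
      finally show ?thesis .
    qed
    have "(\<Sum>e\<in>E - {e0}. c e * M' e f) = 0" using e0 by (simp add: M'_def)
    moreover have "\<exists>e\<in>E. c' e \<noteq> 0" using c(1) by (auto simp: c'_def)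
    ultimately show ?thesis using c(2) sum by (intro exI[of _ c']) auto
  qed
qed

text \<open>The monomials of degree at most \<open>N\<close> in each of the functions number \<open>(N + 1) ^ card I\<close>, but after
  clearing denominators they lie in a space of polynomials whose dimension grows only like
  \<open>N ^ card S\<close>.\<close>

lemma not_alg_indep_on_slice:
  fixes g :: "'i \<Rightarrow> complex^'m \<Rightarrow> complex"
  assumes I: "finite I" and card: "card S < card I" and g: "\<And>i. i \<in> I \<Longrightarrow> regular h (g i)"
  shows "\<not> alg_indep (slice S y \<inter> nonvanishing h) I g"
proof -
  let ?L = "slice S y"
  have "\<forall>i. \<exists>a n. i \<in> I \<longrightarrow> (\<forall>x\<in>nonvanishing h. g i x = peval a (($) x) / peval h (($) x) ^ n)"
    using g unfolding regular_def by blast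
  then obtain a n where a: "\<And>i x. i \<in> I \<Longrightarrow> peval h (($) x) \<noteq> 0 \<Longrightarrow> g i x = peval (a i) (($) x) / peval h (($) x) ^ n i"
    by (simp only: choice_iff) blast
  have "\<forall>i. \<exists>q d. Poly_Mapping.keys q \<subseteq> exponents S d \<and> (\<forall>x\<in>?L. peval (a i) (($) x) = peval q (($) x))"
    using ex_restrict_to_slice by blast
  then obtain a' d where a': "\<And>i. Poly_Mapping.keys (a' i) \<subseteq> exponents S (d i)"
     "\<And>i x. x \<in> ?L \<Longrightarrow> peval (a i) (($) x) = peval (a' i) (($) x)"
    by (simp only: choice_iff) blast
  have "\<forall>i. \<exists>q d. Poly_Mapping.keys q \<subseteq> exponents S d \<and> (\<forall>x\<in>?L. peval (h ^ n i) (($) x) = peval q (($) x))"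
    using ex_restrict_to_slice by blast
  then obtain b' d' where b': "\<And>i. Poly_Mapping.keys (b' i) \<subseteq> exponents S (d' i)"
     "\<And>i x. x \<in> ?L \<Longrightarrow> peval (h ^ n i) (($) x) = peval (b' i) (($) x)"
    by (simp only: choice_iff) blast
  define D where "D = (\<Sum>i\<in>I. d i + d' i)"
  have D: "Poly_Mapping.keys (a' i) \<subseteq> exponents S D" "Poly_Mapping.keys (b' i) \<subseteq> exponents S D" if "i \<in> I" for i
  proof -
    have "d i + d' i \<le> D" unfolding D_def by (rule member_le_sum[OF that _ I]) simp
    then show "Poly_Mapping.keys (a' i) \<subseteq> exponents S D" "Poly_Mapping.keys (b' i) \<subseteq> exponents S D"
      using a'(1)[of i] b'(1)[of i] exponents_mono[of "d i" D S] exponents_mono[of "d' i" D S] by auto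
  qed
  \<comment> \<open>In each variable a cleared monomial has degree at most \<open>card I * (N * D)\<close>, so with \<open>s = card S\<close> the
    polynomials needed span a space of dimension at most \<open>(K * (N + 1)) ^ s = N * (N + 1) ^ s\<close>, less than the
    number of monomials. The constant \<open>N = K ^ s\<close> is chosen for this.\<close>
  define K where "K = card I * D + 1"
  define N where "N = K ^ card S"
  have fS: "finite S" by simp
  have "K \<ge> 1" by (simp add: K_def)
  have "card (exponents S (card I * (N * D))) = (card I * (N * D) + 1) ^ card S"
    by (rule card_exponents[OF fS])
  also have "\<dots> \<le> (K * (N + 1)) ^ card S"
    by (rule power_mono) (simp_all add: K_def algebra_simps)
  also have "\<dots> = N * (N + 1) ^ card S" by (simp only: power_mult_distrib N_def)
  also have "\<dots> < (N + 1) * (N + 1) ^ card S" by simp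
  also have "\<dots> = (N + 1) ^ Suc (card S)" by simp
  also have "\<dots> \<le> (N + 1) ^ card I" using card by (intro power_increasing) auto
  also have "\<dots> = card (exponents I N)" by (rule card_exponents[OF I, symmetric])
  finally have cards: "card (exponents S (card I * (N * D))) < card (exponents I N)" .
  define m where "m e = (\<Prod>i\<in>I. a' i ^ Poly_Mapping.lookup e i * b' i ^ (N - Poly_Mapping.lookup e i))" for e
  have m: "Poly_Mapping.keys (m e) \<subseteq> exponents S (card I * (N * D))" if e: "e \<in> exponents I N" for e
    unfolding m_def
  proof (rule keys_prod_exponents[OF I])
    fix i assume i: "i \<in> I"
    have "Poly_Mapping.lookup e i \<le> N" using e by (simp add: exponents_def)
    then have "N * D = Poly_Mapping.lookup e i * D + (N - Poly_Mapping.lookup e i) * D"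
      by (simp add: add_mult_distrib[symmetric])
    then show "Poly_Mapping.keys (a' i ^ Poly_Mapping.lookup e i * b' i ^ (N - Poly_Mapping.lookup e i)) \<subseteq> exponents S (N * D)"
      by (simp only:) (intro keys_mult_exponents keys_power_exponents D i)
  qed
  from ex_nontrivial_solution[OF finite_exponents[OF fS] finite_exponents[OF I] cards, of "\<lambda>e. Poly_Mapping.lookup (m e)"]
  obtain c where c: "\<exists>e\<in>exponents I N. c e \<noteq> 0"
    "\<forall>f\<in>exponents S (card I * (N * D)). (\<Sum>e\<in>exponents I N. c e * Poly_Mapping.lookup (m e) f) = 0" by blast
  have zero: "(\<Sum>e\<in>exponents I N. c e * peval (m e) x) = 0" for x
  proof -
    have "(\<Sum>e\<in>exponents I N. c e * peval (m e) x) =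
        (\<Sum>e\<in>exponents I N. c e * (\<Sum>f\<in>exponents S (card I * (N * D)). Poly_Mapping.lookup (m e) f * pmonom f x))"
      by (intro sum.cong refl arg_cong2[of _ _ _ _ "(*)"] peval_superset finite_exponents fS m)
    also have "\<dots> = (\<Sum>f\<in>exponents S (card I * (N * D)). (\<Sum>e\<in>exponents I N. c e * Poly_Mapping.lookup (m e) f) * pmonom f x)"
      unfolding sum_distrib_left sum_distrib_right by (subst sum.swap) (simp add: mult_ac)
    also have "\<dots> = 0" using c(2) by simp
    finally show ?thesis .
  qed
  define P where "P = (\<Sum>e\<in>exponents I N. Poly_Mapping.single e (c e))"
  have P: "Poly_Mapping.lookup P e = (if e \<in> exponents I N then c e else 0)" for e
    using finite_exponents[OF I, of N] by (simp add: P_def lookup_sum lookup_single when_def sum.delta)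
  have "P \<noteq> 0" using c(1) P by (metis lookup_zero)
  moreover have "vars P \<subseteq> I"
    unfolding vars_def
  proof (rule UN_least)
    fix e assume "e \<in> Poly_Mapping.keys P"
    then have "e \<in> exponents I N" by (simp add: in_keys_iff P split: if_splits)
    then show "Poly_Mapping.keys e \<subseteq> I" by (simp add: exponents_def)
  qed
  moreover have "peval P (\<lambda>i. g i x) = 0" if x: "x \<in> ?L \<inter> nonvanishing h" for x
  proof -
    let ?h = "peval h (($) x)"
    have h: "?h \<noteq> 0" using x by simp
    have "(\<Prod>i\<in>I. ?h ^ (n i * N)) * pmonom e (\<lambda>i. g i x) = peval (m e) (($) x)" if e: "e \<in> exponents I N" for e
    proof -
      have "pmonom e (\<lambda>i. g i x) = (\<Prod>i\<in>I. g i x ^ Poly_Mapping.lookup e i)"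
        by (rule pmonom_superset[OF I]) (use e in \<open>auto simp: exponents_def\<close>)
      then have "(\<Prod>i\<in>I. ?h ^ (n i * N)) * pmonom e (\<lambda>i. g i x)
          = (\<Prod>i\<in>I. ?h ^ (n i * N) * g i x ^ Poly_Mapping.lookup e i)" by (simp add: prod.distrib)
      also have "\<dots> = (\<Prod>i\<in>I. peval (a' i) (($) x) ^ Poly_Mapping.lookup e i *
          peval (b' i) (($) x) ^ (N - Poly_Mapping.lookup e i))"
      proof (rule prod.cong[OF refl])
        fix i assume i: "i \<in> I"
        have le: "Poly_Mapping.lookup e i \<le> N" using e by (simp add: exponents_def)
        have "?h ^ (n i * N) = (?h ^ n i) ^ Poly_Mapping.lookup e i * (?h ^ n i) ^ (N - Poly_Mapping.lookup e i)"
          using le by (simp add: power_mult power_add[symmetric])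
        then have "?h ^ (n i * N) * g i x ^ Poly_Mapping.lookup e i =
          (g i x * ?h ^ n i) ^ Poly_Mapping.lookup e i * (?h ^ n i) ^ (N - Poly_Mapping.lookup e i)"
          by (simp only: power_mult_distrib mult_ac)
        moreover have "g i x * ?h ^ n i = peval (a' i) (($) x)"
          using a[OF i h] a'(2) x h by simp
        moreover have "?h ^ n i = peval (b' i) (($) x)"
          using b'(2)[of x i] x by (simp add: peval_power)
        ultimately show "?h ^ (n i * N) * g i x ^ Poly_Mapping.lookup e i = peval (a' i) (($) x) ^ Poly_Mapping.lookup e i *
          peval (b' i) (($) x) ^ (N - Poly_Mapping.lookup e i)"
          by (simp only:)
      qed
      also have "\<dots> = peval (m e) (($) x)" by (simp add: m_def peval_prod peval_mult peval_power)
      finally show ?thesis .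
    qed
    then have "(\<Prod>i\<in>I. ?h ^ (n i * N)) * peval P (\<lambda>i. g i x) = (\<Sum>e\<in>exponents I N. c e * peval (m e) (($) x))"
      by (simp add: P_def peval_sum sum_distrib_left mult_ac cong: sum.cong)
    then show ?thesis using zero h I by (simp add: prod_zero_iff)
  qed
  ultimately show ?thesis unfolding alg_indep_def by blast
qed

section \<open>Differentiation of regular maps\<close>

text \<open>Only the values on one line enter, since relations will be known on a slice and not on an open set.\<close>

lemma derivative_zero_along:
  fixes H :: "'a::real_normed_vector \<Rightarrow> 'b::real_normed_vector"
  assumes H: "(H has_derivative H') (at x)" and U: "open U" "x \<in> U"
    and zero: "\<And>t. x + t *\<^sub>R v \<in> U \<Longrightarrow> H (x + t *\<^sub>R v) = 0"
  shows "H' v = 0"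
proof -
  have "((\<lambda>t::real. x + t *\<^sub>R v) has_derivative (\<lambda>t. t *\<^sub>R v)) (at 0)"
    by (auto intro!: derivative_eq_intros)
  moreover have "(H has_derivative H') (at (x + 0 *\<^sub>R v))" using H by simp
  ultimately have 1: "((\<lambda>t. H (x + t *\<^sub>R v)) has_derivative (\<lambda>t. H' (t *\<^sub>R v))) (at 0)"
    by (rule has_derivative_compose)
  have "open ((\<lambda>t. x + t *\<^sub>R v) -` U)"
    by (rule open_vimage[OF U(1)]) (intro continuous_intros)
  then have 2: "((\<lambda>t. H (x + t *\<^sub>R v)) has_derivative (\<lambda>t. 0)) (at (0::real))"
    by (rule has_derivative_transform_within_open[OF has_derivative_const[of 0]])
      (use U zero in auto)
  from fun_cong[OF has_derivative_unique[OF 1 2], of 1] show ?thesis by simp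
qed

lemma peval_vec_has_derivative:
  fixes p :: "'m::finite cpoly"
  shows "((\<lambda>x. peval p (($) x)) has_derivative (\<lambda>v. \<Sum>j\<in>UNIV. peval (pd j p) (($) x) * v $ j)) (at x)"
  by (rule peval_has_derivative[of UNIV p "\<lambda>j x. x $ j", simplified])
    (auto intro: bounded_linear_imp_has_derivative)

lemma open_nonvanishing:
  fixes h :: "'m::finite cpoly"
  shows "open (nonvanishing h)"
proof -
  have "continuous_on UNIV (\<lambda>x. peval h (($) x))"
    by (rule has_derivative_continuous_on) (rule has_derivative_at_withinI[OF peval_vec_has_derivative])
  then show ?thesis by (intro open_Collect_neq continuous_on_const)
qed

text \<open>That the derivative is multiplication by the complex matrix \<open>J x\<close> makes \<open>f\<close> holomorphic with
  Jacobian \<open>J\<close>; that \<open>J\<close> is regular too allows rank conditions to be expressed by regular functions.\<close>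

locale regular_map =
  fixes h :: "'m::finite cpoly" and f :: "complex^'m \<Rightarrow> complex^'n::finite"
    and J :: "complex^'m \<Rightarrow> complex^'m^'n"
  assumes regular_f: "\<And>i. regular h (\<lambda>x. f x $ i)"
    and regular_J: "\<And>i j. regular h (\<lambda>x. J x $ i $ j)"
    and f_has_derivative:
      "\<And>x i. x \<in> nonvanishing h \<Longrightarrow> ((\<lambda>x. f x $ i) has_derivative (\<lambda>v. (J x *v v) $ i)) (at x)"
    and ex_nonvanishing: "nonvanishing h \<noteq> {}"
begin

lemma regular_peval_f: "regular h (\<lambda>x. peval p (($) (f x)))"
  by (rule regular_compose[of p h "\<lambda>i x. f x $ i"]) (rule regular_f)

lemma peval_f_has_derivative:
  assumes "x \<in> nonvanishing h"
  shows "((\<lambda>x. peval p (($) (f x))) has_derivative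
    (\<lambda>v. \<Sum>i\<in>UNIV. peval (pd i p) (($) (f x)) * (J x *v v) $ i)) (at x)"
  using peval_has_derivative[of UNIV p "\<lambda>i x. f x $ i" "\<lambda>i v. (J x *v v) $ i" x] f_has_derivative[OF assms] by simp

text \<open>A relation valid on a slice may be differentiated in the directions of the slice.\<close>

lemma relation_derivative:
  assumes I: "finite I" "vars p \<subseteq> I"
    and g: "\<And>i. i \<in> I \<Longrightarrow> (g i has_derivative g' i) (at x)"
    and x: "x \<in> slice S y \<inter> nonvanishing h"
    and rel: "\<And>z. z \<in> slice S y \<inter> nonvanishing h \<Longrightarrow> peval p (\<lambda>i. g i z) = 0"
    and v: "\<And>j. j \<notin> S \<Longrightarrow> v $ j = 0"
  shows "(\<Sum>i\<in>I. peval (pd i p) (\<lambda>i. g i x) * g' i v) = 0"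
proof (rule derivative_zero_along[OF peval_has_derivative[OF I g] open_nonvanishing])
  show "x \<in> nonvanishing h" using x by simp
  fix t assume "x + t *\<^sub>R v \<in> nonvanishing h"
  moreover have "x + t *\<^sub>R v \<in> slice S y" using x v by (auto simp: slice_def)
  ultimately show "peval p (\<lambda>i. g i (x + t *\<^sub>R v)) = 0" by (intro rel) simp
qed

text \<open>Algebraically independent functions of \<open>f\<close> bound the rank of the Jacobian from below. Extend the
  family by as many coordinate functions \<open>T\<close> as independence allows; by counting, together they are at
  most as many as there are coordinates. Each further coordinate is algebraic over the extended
  family, and the derivative of the relation shows that a vector in the kernel of the Jacobian
  vanishes in this coordinate once it vanishes in the coordinates \<open>T\<close>.\<close>

lemma card_alg_indep_le_rank:
  fixes F :: "'k \<Rightarrow> 'n cpoly"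
  assumes K: "finite K" and ind: "alg_indep (nonvanishing h) K (\<lambda>k x. peval (F k) (($) (f x)))"
  shows "\<exists>q\<in>nonvanishing h. card K \<le> rank (J q)"
proof -
  define g where "g = case_sum (\<lambda>k x. peval (F k) (($) (f x))) (\<lambda>t x. x $ t :: complex)"
  define g' where "g' x = case_sum (\<lambda>k v. \<Sum>i\<in>UNIV. peval (pd i (F k)) (($) (f x)) * (J x *v v) $ i) (\<lambda>t v. v $ t :: complex)" for x
  have g_deriv: "(g i has_derivative g' x i) (at x)" if "x \<in> nonvanishing h" for x i
    by (cases i) (auto simp: g_def g'_def intro: peval_f_has_derivative[OF that] bounded_linear_imp_has_derivative)
  have g_reg: "regular h (g i)" for i
    by (cases i) (auto simp: g_def intro: regular_peval_f regular_component)
  let ?I = "\<lambda>T. Inl ` K \<union> Inr ` T :: ('k + 'm) set"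
  let ?A = "{T. alg_indep (nonvanishing h) (?I T) g}"
  have "alg_indep (nonvanishing h) (Inl ` K) g"
    by (rule alg_indep_reindex) (use ind in \<open>auto simp: g_def\<close>)
  then have "{} \<in> ?A" by simp
  moreover have "finite ?A" by simp
  ultimately have "\<exists>T\<in>?A. \<forall>T'\<in>?A. T \<subseteq> T' \<longrightarrow> T = T'"
    by (intro finite_has_maximal) blast+
  then obtain T where T: "alg_indep (nonvanishing h) (?I T) g"
    and max: "\<And>T'. alg_indep (nonvanishing h) (?I T') g \<Longrightarrow> T \<subseteq> T' \<Longrightarrow> T = T'"
    by blast
  have finI: "finite (?I T)" using K by simp
  have "card (?I T) = card K + card T"
    using K by (subst card_Un_disjoint) (auto simp: card_image)
  moreover have "\<not> CARD('m) < card (?I T)"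
    using not_alg_indep_on_slice[OF finI, of UNIV h g undefined] g_reg T by auto
  ultimately have card: "card K \<le> card (- T)" by (simp add: Compl_eq_Diff_UNIV card_Diff_subset)
  have "\<exists>p x. t \<notin> T \<longrightarrow> vars p \<subseteq> insert (Inr t) (?I T) \<and> (\<forall>x\<in>nonvanishing h. peval p (\<lambda>i. g i x) = 0) \<and>
      x \<in> nonvanishing h \<and> peval (pd (Inr t) p) (\<lambda>i. g i x) \<noteq> 0" for t
  proof (cases "t \<in> T")
    case False
    then have "\<not> alg_indep (nonvanishing h) (insert (Inr t) (?I T)) g"
      using max[of "insert t T"] by auto
    from T this show ?thesis by (rule ex_relation_pd_nonzero) blast
  qed blast
  then have "\<forall>t. \<exists>p x. t \<notin> T \<longrightarrow> vars p \<subseteq> insert (Inr t) (?I T) \<and> (\<forall>x\<in>nonvanishing h. peval p (\<lambda>i. g i x) = 0) \<and>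
      x \<in> nonvanishing h \<and> peval (pd (Inr t) p) (\<lambda>i. g i x) \<noteq> 0" by (rule allI)
  then obtain P y where P: "\<And>t. t \<notin> T \<Longrightarrow> vars (P t) \<subseteq> insert (Inr t) (?I T)"
    "\<And>t x. t \<notin> T \<Longrightarrow> x \<in> nonvanishing h \<Longrightarrow> peval (P t) (\<lambda>i. g i x) = 0"
    "\<And>t. t \<notin> T \<Longrightarrow> y t \<in> nonvanishing h \<and> peval (pd (Inr t) (P t)) (\<lambda>i. g i (y t)) \<noteq> 0"
    by (simp only: choice_iff) blast
  obtain z where z: "z \<in> slice UNIV z \<inter> nonvanishing h"
    "\<And>t. t \<in> - T \<Longrightarrow> peval (pd (Inr t) (P t)) (\<lambda>i. g i z) \<noteq> 0"
  proof (rule regular_nonzero_prod[of "- T" h "\<lambda>t x. peval (pd (Inr t) (P t)) (\<lambda>i. g i x)" UNIV undefined])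
    show "regular h (\<lambda>x. peval (pd (Inr t) (P t)) (\<lambda>i. g i x))" for t
      by (rule regular_compose) (rule g_reg)
    show "\<exists>x\<in>slice UNIV undefined \<inter> nonvanishing h. peval (pd (Inr t) (P t)) (\<lambda>i. g i x) \<noteq> 0" if "t \<in> - T" for t
      using P(3)[of t] that by auto
  qed (use ex_nonvanishing in auto)
  have "indep_columns (J z) (- T)"
    unfolding indep_columns_def
  proof (intro allI impI)
    fix w assume w: "\<forall>j. j \<notin> - T \<longrightarrow> w $ j = 0" "J z *v w = 0"
    have "w $ t = 0" if t: "t \<notin> T" for t
    proof -
      have "(\<Sum>i\<in>insert (Inr t) (?I T). peval (pd i (P t)) (\<lambda>i. g i z) * g' z i w) = 0"
        by (rule relation_derivative[where S = UNIV and y = z]) (use finI P t z g_deriv in auto)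
      moreover have "(\<Sum>i\<in>?I T. peval (pd i (P t)) (\<lambda>i. g i z) * g' z i w) = 0"
        by (rule sum.neutral) (use w in \<open>auto simp: g'_def\<close>)
      moreover have "Inr t \<notin> ?I T" using t by auto
      ultimately have "peval (pd (Inr t) (P t)) (\<lambda>i. g i z) * g' z (Inr t) w = 0"
        using finI by simp
      then show ?thesis using z(2)[of t] t by (simp add: g'_def)
    qed
    then show "w = 0" using w by (auto simp: vec_eq_iff)
  qed
  from card_le_rank[OF this] card z show ?thesis by (intro bexI[of _ z]) auto
qed

text \<open>As row rank equals column rank, there are as many rows \<open>R\<close> that stay independent when only the
  columns \<open>S\<close> are kept, at \<open>p\<close> and hence generically on the slice. There the gradient of a relation between the
  components \<open>R\<close>, annihilated by these columns, vanishes; so the partial derivatives of a relation are relations.\<close>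

lemma ex_alg_indep_on_slice:
  assumes p: "p \<in> nonvanishing h" and S: "indep_columns (J p) S"
  obtains R where "card R = card S" "alg_indep (slice S p \<inter> nonvanishing h) R (\<lambda>i x. f x $ i)"
proof -
  \<comment> \<open>The transpose of the columns \<open>S\<close> of the Jacobian, so that its columns belong to components of \<open>f\<close>.\<close>
  define B where "B x = (\<chi> j i. if j \<in> S then J x $ i $ j else 0)" for x
  have "indep_columns (transpose (B p)) S"
    unfolding indep_columns_def
  proof (intro allI impI)
    fix w assume w: "\<forall>j. j \<notin> S \<longrightarrow> w $ j = 0" "transpose (B p) *v w = 0"
    have "transpose (B p) *v w = J p *v w"
      using w(1) by (auto simp: B_def transpose_def matrix_vector_mult_def vec_eq_iff intro!: sum.cong)
    then show "w = 0" using indep_columnsD[OF S, of w] w by simp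
  qed
  from card_le_rank[OF this] have "card S \<le> rank (B p)" by (simp add: rank_transpose_field)
  moreover obtain R' where R': "card R' = rank (B p)" "indep_columns (B p) R'" by (rule ex_indep_columns)
  ultimately obtain R where R: "R \<subseteq> R'" "card R = card S" by (metis obtain_subset_with_card_n)
  have B: "regular h (\<lambda>x. B x $ i $ j)" for i j
    by (cases "i \<in> S") (auto simp: B_def intro: regular_J regular_const)
  obtain \<delta> where \<delta>: "regular h \<delta>" "\<delta> p \<noteq> 0" "\<And>x. \<delta> x \<noteq> 0 \<Longrightarrow> indep_columns (B x) R"
    by (rule indep_columns_open[OF B indep_columns_mono[OF R'(2) R(1)]]) (rule that)
  have "alg_indep (slice S p \<inter> nonvanishing h) R (\<lambda>i x. f x $ i)"
  proof (rule alg_indep_if_pd_closed)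
    show "slice S p \<inter> nonvanishing h \<noteq> {}" using p slice_base by blast
    fix q i x assume q: "vars q \<subseteq> R"
      and rel: "\<And>x. x \<in> slice S p \<inter> nonvanishing h \<Longrightarrow> peval q (\<lambda>i. f x $ i) = 0"
      and i: "i \<in> R" and x: "x \<in> slice S p \<inter> nonvanishing h"
    show "peval (pd i q) (\<lambda>i. f x $ i) = 0"
    proof (rule regular_mult_eq_0[OF regular_peval_f \<delta>(1) _ _ \<delta>(2) x])
      fix x assume x: "x \<in> slice S p \<inter> nonvanishing h"
      show "peval (pd i q) (($) (f x)) * \<delta> x = 0"
      proof (cases "\<delta> x = 0")
        case False
        define c where "c = (\<chi> i. if i \<in> R then peval (pd i q) (($) (f x)) else 0)"
        have "(B x *v c) $ j = 0" for j
        proof (cases "j \<in> S")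
          case True
          have Jj: "(J x *v axis j 1) $ i = J x $ i $ j" for i
            by (simp add: matrix_vector_mult_def axis_def if_distrib cong: if_cong)
          have "(\<Sum>i\<in>R. peval (pd i q) (\<lambda>i. f x $ i) * (J x *v axis j 1) $ i) = 0"
            by (rule relation_derivative[where S = S and y = p, OF _ q f_has_derivative x rel])
              (use True x in \<open>auto simp: axis_def\<close>)
          then have "(\<Sum>i\<in>R. J x $ i $ j * c $ i) = 0"
            unfolding Jj by (simp add: c_def mult.commute cong: sum.cong)
          moreover have "(\<Sum>i\<in>UNIV. J x $ i $ j * c $ i) = (\<Sum>i\<in>R. J x $ i $ j * c $ i)"
            by (rule sum.mono_neutral_right) (auto simp: c_def)
          ultimately show ?thesis using True by (simp add: B_def matrix_vector_mult_def)
        qed (simp add: B_def matrix_vector_mult_def)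
        then have "B x *v c = 0" by (simp add: vec_eq_iff)
        with indep_columnsD[OF \<delta>(3)[OF False], of c] have "c = 0" by (auto simp: c_def)
        then have "c $ i = 0" by simp
        then show ?thesis using i by (simp add: c_def)
      qed simp
    qed (use p in simp)
  qed simp
  with R(2) show thesis by (rule that)
qed

end

section \<open>The dimension of the closure of the image\<close>

lemma zariski_closure_of:
  "zariski closure_of S = {x. \<forall>p. (\<forall>s\<in>S. peval p (($) s) = 0) \<longrightarrow> peval p (($) x) = 0}" (is "_ = ?C")
proof (rule antisym)
  have "closedin zariski ?C"
    unfolding closedin_zariski by (rule exI[of _ "{p. \<forall>s\<in>S. peval p (($) s) = 0}"]) auto
  then show "zariski closure_of S \<subseteq> ?C" by (rule closure_of_minimal[rotated]) auto
  show "?C \<subseteq> zariski closure_of S"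
  proof
    fix x assume x: "x \<in> ?C"
    obtain P where P: "zariski closure_of S = {x. \<forall>p\<in>P. peval p (($) x) = 0}"
      using closedin_closure_of[of zariski S] unfolding closedin_zariski by blast
    have "S \<subseteq> zariski closure_of S" by (rule closure_of_subset) simp
    then show "x \<in> zariski closure_of S" using x unfolding P by blast
  qed
qed

lemma closedin_zero_set: "closedin zariski {x. peval p (($) x) = 0}"
  unfolding closedin_zariski by (rule exI[of _ "{p}"]) simp

text \<open>The vanishing ideal of an irreducible set is prime.\<close>

lemma irreducible_in_mult_eq_0:
  assumes Z: "irreducible_in (subtopology zariski X) Z"
    and pq: "\<And>x. x \<in> Z \<Longrightarrow> peval p (($) x) * peval q (($) x) = 0"
    and y: "y \<in> Z" "peval p (($) y) \<noteq> 0" and x: "x \<in> Z"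
  shows "peval q (($) x) = 0"
proof -
  let ?V = "\<lambda>p. {x. peval p (($) x) = 0} \<inter> X"
  have "closedin (subtopology zariski X) (?V p)" for p
    unfolding closedin_subtopology using closedin_zero_set by blast
  moreover have "Z \<subseteq> X" using Z by (simp add: irreducible_in_def)
  then have "Z \<subseteq> ?V p \<union> ?V q" using pq by auto
  ultimately have "Z \<subseteq> ?V p \<or> Z \<subseteq> ?V q"
    using Z unfolding irreducible_in_def by blast
  then show ?thesis using x y by auto
qed

text \<open>Functions separating the members of a chain of irreducible closed sets are algebraically
  independent on the top member. In a relation \<open>p\<close> between them, the part \<open>p0\<close> free of the last
  variable is a relation on the previous member, where the last function vanishes; hence it is zero
  and the last variable can be cancelled.\<close>

lemma alg_indep_chain:
  fixes Z :: "nat \<Rightarrow> (complex^'n) set"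
  assumes "\<And>i. i \<le> k \<Longrightarrow> irreducible_in (subtopology zariski X) (Z i)"
    and "\<And>i. i < k \<Longrightarrow> Z i \<subseteq> Z (Suc i)"
    and "\<And>i x. i < k \<Longrightarrow> x \<in> Z i \<Longrightarrow> peval (F i) (($) x) = 0"
    and "\<And>i. i < k \<Longrightarrow> \<exists>x\<in>Z (Suc i). peval (F i) (($) x) \<noteq> 0"
  shows "alg_indep (Z k) {..<k} (\<lambda>i x. peval (F i) (($) x))"
  using assms
proof (induction k)
  case 0
  then have "Z 0 \<noteq> {}" by (simp add: irreducible_in_def)
  then show ?case by (simp add: alg_indep_empty)
next
  case (Suc k)
  have IH: "alg_indep (Z k) {..<k} (\<lambda>i x. peval (F i) (($) x))"
    by (rule Suc.IH) (use Suc.prems in auto)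
  have sub: "Z k \<subseteq> Z (Suc k)" using Suc.prems(2) by simp
  have "p = 0" if "\<And>e. e \<in> Poly_Mapping.keys p \<Longrightarrow> Poly_Mapping.lookup e k \<le> d"
    "vars p \<subseteq> {..<Suc k}" "\<And>x. x \<in> Z (Suc k) \<Longrightarrow> peval p (\<lambda>i. peval (F i) (($) x)) = 0" for d p
    using that
  proof (induction d arbitrary: p)
    case 0
    then have "k \<notin> vars p" by (auto simp: vars_def in_keys_iff)
    with 0(2) have "vars p \<subseteq> {..<k}" by (auto simp: less_Suc_eq)
    from alg_indepD[OF IH this] show ?case using 0(3) sub by blast
  next
    case (Suc d)
    obtain p0 q where pq: "p = p0 + Var k * q" "vars p0 \<subseteq> vars p - {k}" "vars q \<subseteq> vars p"
      "\<And>e. e \<in> Poly_Mapping.keys q \<Longrightarrow> e + Poly_Mapping.single k 1 \<in> Poly_Mapping.keys p"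
      by (rule cpoly_split_variable[of p k]) (rule that)
    have "p0 = 0"
    proof (rule alg_indepD[OF IH])
      show "vars p0 \<subseteq> {..<k}" using pq(2) Suc.prems(2) by (fastforce simp: less_Suc_eq)
      fix x assume x: "x \<in> Z k"
      then have "peval (F k) (($) x) = 0" using \<open>\<And>i x. i < Suc k \<Longrightarrow> x \<in> Z i \<Longrightarrow> peval (F i) (($) x) = 0\<close> by simp
      then show "peval p0 (\<lambda>i. peval (F i) (($) x)) = 0"
        using Suc.prems(3)[of x] x sub by (auto simp: pq(1) peval_add peval_mult)
    qed
    obtain q' where q': "\<And>x. peval q' x = peval q (\<lambda>i. peval (F i) x)" using ex_subst[of q F] by blast
    have "q = 0"
    proof (rule Suc.IH)
      fix e assume "e \<in> Poly_Mapping.keys q"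
      from Suc.prems(1)[OF pq(4)[OF this]] show "Poly_Mapping.lookup e k \<le> d" by (simp add: lookup_add)
    next
      show "vars q \<subseteq> {..<Suc k}" using pq(3) Suc.prems(2) by blast
    next
      fix x assume x: "x \<in> Z (Suc k)"
      obtain y where y: "y \<in> Z (Suc k)" "peval (F k) (($) y) \<noteq> 0"
        using \<open>\<And>i. i < Suc k \<Longrightarrow> \<exists>x\<in>Z (Suc i). peval (F i) (($) x) \<noteq> 0\<close> by blast
      have "irreducible_in (subtopology zariski X) (Z (Suc k))"
        using \<open>\<And>i. i \<le> Suc k \<Longrightarrow> irreducible_in (subtopology zariski X) (Z i)\<close> by simp
      then have "peval q' (($) x) = 0"
        by (rule irreducible_in_mult_eq_0[OF _ _ y x])
          (use Suc.prems(3) in \<open>auto simp: q' pq(1) \<open>p0 = 0\<close> peval_mult\<close>)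
      then show "peval q (\<lambda>i. peval (F i) (($) x)) = 0" by (simp add: q')
    qed
    then show ?case using pq(1) \<open>p0 = 0\<close> by simp
  qed
  moreover have "\<exists>d. \<forall>e\<in>Poly_Mapping.keys p. Poly_Mapping.lookup e k \<le> d" for p :: "nat cpoly"
    by (rule exI[of _ "Max ((\<lambda>e. Poly_Mapping.lookup e k) ` Poly_Mapping.keys p)"]) auto
  ultimately show ?case unfolding alg_indep_def by metis
qed

context regular_map
begin

text \<open>Polynomials cutting out two closed sets that cover the image would pull back to nonzero regular
  functions on the slice with product zero.\<close>

lemma irreducible_closure_slice:
  assumes p: "p \<in> nonvanishing h"
    and X: "zariski closure_of (f ` (slice S p \<inter> nonvanishing h)) \<subseteq> X" (is "?Z \<subseteq> X")
  shows "irreducible_in (subtopology zariski X) ?Z"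
  unfolding irreducible_in_def
proof (intro conjI allI impI)
  let ?D = "slice S p \<inter> nonvanishing h"
  have sub: "f ` ?D \<subseteq> ?Z" by (rule closure_of_subset) simp
  show "?Z \<subseteq> topspace (subtopology zariski X)" using X by simp
  show "?Z \<noteq> {}" using sub p slice_base[of p S] by blast
  fix A B assume A: "closedin (subtopology zariski X) A" and B: "closedin (subtopology zariski X) B"
    and AB: "?Z \<subseteq> A \<union> B"
  have cut: "\<exists>q. (\<forall>x\<in>C. peval q (($) x) = 0) \<and> (\<exists>x\<in>?D. peval q (($) (f x)) \<noteq> 0)"
    if C: "closedin (subtopology zariski X) C" "\<not> ?Z \<subseteq> C" for C
  proof -
    obtain P where P: "C = {x. \<forall>p\<in>P. peval p (($) x) = 0} \<inter> X"
      using C(1) unfolding closedin_subtopology closedin_zariski by blast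
    obtain z q where z: "z \<in> ?Z" "q \<in> P" "peval q (($) z) \<noteq> 0" using C(2) X unfolding P by blast
    then have "\<exists>x\<in>?D. peval q (($) (f x)) \<noteq> 0" unfolding zariski_closure_of by auto
    then show ?thesis using z(2) P by blast
  qed
  show "?Z \<subseteq> A \<or> ?Z \<subseteq> B"
  proof (rule ccontr)
    assume "\<not> (?Z \<subseteq> A \<or> ?Z \<subseteq> B)"
    then have "\<not> ?Z \<subseteq> A" "\<not> ?Z \<subseteq> B" by auto
    obtain q x where q: "\<forall>x\<in>A. peval q (($) x) = 0" "x \<in> ?D" "peval q (($) (f x)) \<noteq> 0"
      using cut[OF A \<open>\<not> ?Z \<subseteq> A\<close>] by blast
    obtain r y where r: "\<forall>x\<in>B. peval r (($) x) = 0" "y \<in> ?D" "peval r (($) (f y)) \<noteq> 0"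
      using cut[OF B \<open>\<not> ?Z \<subseteq> B\<close>] by blast
    have "peval q (($) (f x)) = 0"
    proof (rule regular_mult_eq_0[OF regular_peval_f regular_peval_f _ r(2,3) q(2)])
      fix z assume "z \<in> ?D"
      then have "f z \<in> A \<union> B" using sub AB by blast
      then show "peval q (($) (f z)) * peval r (($) (f z)) = 0" using q(1) r(1) by auto
    qed
    then show False using q(3) by simp
  qed
qed

text \<open>Functions separating a chain of length \<open>k\<close> are \<open>k\<close> independent functions on the image, hence
  pull back to independent functions of \<open>f\<close> and force the rank up to \<open>k\<close>.\<close>

lemma zariski_dim_le_rank:
  assumes max: "\<And>q. q \<in> nonvanishing h \<Longrightarrow> rank (J q) \<le> r"
  shows "zariski_dim (zariski closure_of (f ` nonvanishing h)) \<le> enat r"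
  unfolding zariski_dim_def krull_dim_def
proof (rule Sup_least, safe)
  let ?X = "zariski closure_of (f ` nonvanishing h)"
  fix k and C :: "nat \<Rightarrow> (complex^'n) set"
  assume C: "\<forall>i\<le>k. closedin (subtopology zariski ?X) (C i) \<and> irreducible_in (subtopology zariski ?X) (C i)"
    and str: "\<forall>i<k. C i \<subset> C (Suc i)"
  have "\<exists>p. (\<forall>x\<in>C i. peval p (($) x) = 0) \<and> (\<exists>x\<in>C (Suc i). peval p (($) x) \<noteq> 0)" if i: "i < k" for i
  proof -
    have "closedin (subtopology zariski ?X) (C i)" using C i by simp
    then obtain P where P: "C i = {x. \<forall>p\<in>P. peval p (($) x) = 0} \<inter> ?X"
      unfolding closedin_subtopology closedin_zariski by blast
    have "C (Suc i) \<subseteq> ?X" using C i by (auto simp: irreducible_in_def Suc_le_eq)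
    moreover obtain x where "x \<in> C (Suc i)" "x \<notin> C i" using str i by blast
    moreover from calculation obtain p where "p \<in> P" "peval p (($) x) \<noteq> 0" unfolding P by blast
    ultimately show ?thesis using P by blast
  qed
  then obtain F where F: "\<And>i x. i < k \<Longrightarrow> x \<in> C i \<Longrightarrow> peval (F i) (($) x) = 0"
    "\<And>i. i < k \<Longrightarrow> \<exists>x\<in>C (Suc i). peval (F i) (($) x) \<noteq> 0" by metis
  have Ck: "alg_indep (C k) {..<k} (\<lambda>i x. peval (F i) (($) x))"
    by (rule alg_indep_chain[of k ?X]) (use C str F in auto)
  have "alg_indep (nonvanishing h) {..<k} (\<lambda>i x. peval (F i) (($) (f x)))"
    unfolding alg_indep_def
  proof (intro allI impI)
    fix p assume p: "vars p \<subseteq> {..<k}" "\<forall>x\<in>nonvanishing h. peval p (\<lambda>i. peval (F i) (($) (f x))) = 0"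
    obtain p' where p': "\<And>x. peval p' x = peval p (\<lambda>i. peval (F i) x)" using ex_subst[of p F] by blast
    have "C k \<subseteq> ?X" using C by (auto simp: irreducible_in_def)
    moreover have "\<forall>y\<in>f ` nonvanishing h. peval p' (($) y) = 0" using p(2) by (simp add: p')
    then have "peval p' (($) x) = 0" if "x \<in> ?X" for x
      using that unfolding zariski_closure_of by blast
    ultimately have "\<forall>x\<in>C k. peval p (\<lambda>i. peval (F i) (($) x)) = 0" using p' by auto
    then show "p = 0" using alg_indepD[OF Ck p(1)] by blast
  qed
  from card_alg_indep_le_rank[OF _ this] obtain q where "q \<in> nonvanishing h" "k \<le> rank (J q)" by auto
  with max[of q] show "enat k \<le> enat r" by simp
qed

text \<open>A chain of the length of the rank is formed by the images of slices of increasing dimension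
  spanned by independent columns: the components independent on the larger slice are dependent on the
  smaller one for lack of variables.\<close>

lemma rank_le_zariski_dim:
  assumes p: "p \<in> nonvanishing h"
  shows "enat (rank (J p)) \<le> zariski_dim (zariski closure_of (f ` nonvanishing h))"
proof -
  let ?X = "zariski closure_of (f ` nonvanishing h)"
  obtain S where S: "card S = rank (J p)" "indep_columns (J p) S" by (rule ex_indep_columns)
  obtain s where s: "bij_betw s {..<rank (J p)} S"
    using ex_bij_betw_nat_finite[of S] S(1) by (auto simp: lessThan_atLeast0)
  define T where "T k = s ` {..<k}" for k
  define Z where "Z k = zariski closure_of (f ` (slice (T k) p \<inter> nonvanishing h))" for k
  have cardT: "card (T k) = k" and TS: "T k \<subseteq> S" if "k \<le> rank (J p)" for k
    using s that by (auto simp: T_def bij_betw_def card_image inj_on_subset)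
  have ZX: "Z k \<subseteq> ?X" for k unfolding Z_def by (rule closure_of_mono) auto
  have "closedin (subtopology zariski ?X) (Z k)" for k
    unfolding closedin_subtopology using ZX[of k] closedin_closure_of[of zariski]
    by (intro exI[of _ "Z k"]) (auto simp: Z_def)
  moreover have "irreducible_in (subtopology zariski ?X) (Z k)" for k
    using irreducible_closure_slice[OF p] ZX[of k] unfolding Z_def by blast
  moreover have "Z k \<subset> Z (Suc k)" if k: "k < rank (J p)" for k
  proof
    have "slice (T k) p \<subseteq> slice (T (Suc k)) p" by (auto simp: slice_def T_def lessThan_Suc)
    then show "Z k \<subseteq> Z (Suc k)" unfolding Z_def by (intro closure_of_mono) auto
    obtain R where R: "card R = card (T (Suc k))"
      "alg_indep (slice (T (Suc k)) p \<inter> nonvanishing h) R (\<lambda>i x. f x $ i)"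
      using ex_alg_indep_on_slice[OF p indep_columns_mono[OF S(2) TS[of "Suc k"]]] k by auto
    have "\<not> alg_indep (slice (T k) p \<inter> nonvanishing h) R (\<lambda>i x. f x $ i)"
      by (rule not_alg_indep_on_slice) (use R(1) k cardT[of k] cardT[of "Suc k"] regular_f in auto)
    then obtain q where q: "vars q \<subseteq> R" "q \<noteq> 0"
      "\<And>x. x \<in> slice (T k) p \<inter> nonvanishing h \<Longrightarrow> peval q (($) (f x)) = 0"
      by (auto simp: alg_indep_def)
    have q0: "peval q (($) y) = 0" if "y \<in> Z k" for y
      using that q(3) unfolding Z_def zariski_closure_of by blast
    have "f ` (slice (T (Suc k)) p \<inter> nonvanishing h) \<subseteq> Z (Suc k)"
      unfolding Z_def by (rule closure_of_subset) simp
    then show "Z k \<noteq> Z (Suc k)" using q0 q(2) alg_indepD[OF R(2) q(1)] by blast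
  qed
  ultimately show ?thesis
    unfolding zariski_dim_def krull_dim_def by (intro Sup_upper) blast
qed

end

section \<open>Vector fields tangent to the image\<close>

context regular_map
begin

text \<open>Choose a maximal set \<open>R\<close> of algebraically independent components of \<open>f\<close>; it has at most as many
  elements as the maximal rank. At a generic point the gradients of the relations between \<open>R\<close> and each further
  component determine a vector in their common kernel by its coordinates in \<open>R\<close>. This kernel contains the
  columns of the Jacobian and the vector field \<open>w\<close>, so that the Jacobian augmented by the column \<open>w\<close> has
  rank at most \<open>card R\<close>. As independence of columns is an open condition, \<open>w\<close> cannot leave
  the column space at any point of maximal rank, although the image may be singular there.\<close>

lemma tangent_in_range_jacobian:
  assumes max: "\<And>q. q \<in> nonvanishing h \<Longrightarrow> rank (J q) \<le> rank (J p)"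
    and p: "p \<in> nonvanishing h"
    and w_reg: "\<And>i. regular h (\<lambda>x. w x $ i)"
    and tan: "\<And>q x. (\<And>y. y \<in> nonvanishing h \<Longrightarrow> peval q (($) (f y)) = 0) \<Longrightarrow> x \<in> nonvanishing h \<Longrightarrow>
      (\<Sum>i\<in>UNIV. peval (pd i q) (($) (f x)) * w x $ i) = 0"
  shows "w p \<in> range ((*v) (J p))"
proof (rule ccontr)
  assume notin: "w p \<notin> range ((*v) (J p))"
  let ?D = "nonvanishing h" and ?g = "\<lambda>i x. f x $ i"
  have "alg_indep ?D {} ?g" using p by (intro alg_indep_empty) auto
  then have "\<exists>R\<in>{R. alg_indep ?D R ?g}. \<forall>R'\<in>{R. alg_indep ?D R ?g}. R \<subseteq> R' \<longrightarrow> R = R'"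
    by (intro finite_has_maximal) auto
  then obtain R where R: "alg_indep ?D R ?g" and Rmax: "\<And>R'. alg_indep ?D R' ?g \<Longrightarrow> R \<subseteq> R' \<Longrightarrow> R = R'"
    by blast
  have cardR: "card R \<le> rank (J p)"
    using card_alg_indep_le_rank[of R Var] R max by fastforce
  have "\<exists>q x. j \<notin> R \<longrightarrow> vars q \<subseteq> insert j R \<and> (\<forall>x\<in>?D. peval q (($) (f x)) = 0) \<and>
      x \<in> ?D \<and> peval (pd j q) (($) (f x)) \<noteq> 0" for j
  proof (cases "j \<in> R")
    case False
    then have "\<not> alg_indep ?D (insert j R) ?g" using Rmax[of "insert j R"] by auto
    from R this show ?thesis by (rule ex_relation_pd_nonzero) blast
  qed blast
  then have "\<forall>j. \<exists>q x. j \<notin> R \<longrightarrow> vars q \<subseteq> insert j R \<and> (\<forall>x\<in>?D. peval q (($) (f x)) = 0) \<and>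
      x \<in> ?D \<and> peval (pd j q) (($) (f x)) \<noteq> 0" by (rule allI)
  then obtain P y where P: "\<And>j. j \<notin> R \<Longrightarrow> vars (P j) \<subseteq> insert j R"
    "\<And>j x. j \<notin> R \<Longrightarrow> x \<in> ?D \<Longrightarrow> peval (P j) (($) (f x)) = 0"
    "\<And>j. j \<notin> R \<Longrightarrow> y j \<in> ?D \<and> peval (pd j (P j)) (($) (f (y j))) \<noteq> 0"
    by (simp only: choice_iff) blast
  \<comment> \<open>The Jacobian augmented by the column \<open>w x\<close>, which has the index \<open>None\<close>.\<close>
  define B where "B x = (\<chi> i j. case j of None \<Rightarrow> w x $ i | Some j \<Rightarrow> J x $ i $ j)" for x
  have B_mult: "B x *v u = u $ None *s w x + J x *v (\<chi> j. u $ Some j)" for x u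
    by (simp add: vec_eq_iff B_def matrix_vector_mult_def UNIV_option_conv sum.reindex mult.commute)
  have B_reg: "regular h (\<lambda>x. B x $ i $ j)" for i j
    by (cases j) (auto simp: B_def intro: w_reg regular_J)
  obtain S where S: "card S = rank (J p)" "indep_columns (J p) S" by (rule ex_indep_columns)
  let ?S = "insert None (Some ` S)"
  have "indep_columns (B p) ?S"
    unfolding indep_columns_def
  proof (intro allI impI)
    fix u assume u: "\<forall>j. j \<notin> ?S \<longrightarrow> u $ j = 0" "B p *v u = 0"
    let ?u = "\<chi> j. u $ Some j"
    have "u $ None = 0"
    proof (rule ccontr)
      assume nz: "u $ None \<noteq> 0"
      have "w p = (- inverse (u $ None)) *s (J p *v ?u)"
        using u(2) nz unfolding B_mult by (simp add: vec_eq_iff field_simps add_eq_0_iff)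
      then have "w p = J p *v ((- inverse (u $ None)) *s ?u)" by (simp only: vec.scale)
      then show False using notin by blast
    qed
    moreover from this have "J p *v ?u = 0" using u(2) unfolding B_mult by simp
    with indep_columnsD[OF S(2), of ?u] u(1) have "?u = 0" by auto
    then have "u $ Some j = 0" for j by (simp add: vec_eq_iff)
    ultimately show "u = 0" by (auto simp: vec_eq_iff split_option_all)
  qed
  from B_reg this obtain \<delta> where \<delta>: "regular h \<delta>" "\<delta> p \<noteq> 0" "\<And>x. \<delta> x \<noteq> 0 \<Longrightarrow> indep_columns (B x) ?S"
    by (rule indep_columns_open) (rule that)
  obtain z0 where z0: "z0 \<in> slice UNIV p \<inter> ?D" "\<And>j. j \<in> - R \<Longrightarrow> peval (pd j (P j)) (($) (f z0)) \<noteq> 0"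
  proof (rule regular_nonzero_prod[of "- R" h "\<lambda>j x. peval (pd j (P j)) (($) (f x))" UNIV p])
    show "\<exists>x\<in>slice UNIV p \<inter> ?D. peval (pd j (P j)) (($) (f x)) \<noteq> 0" if "j \<in> - R" for j
      using P(3)[of j] that by auto
  qed (use p in \<open>auto intro: regular_peval_f\<close>)
  obtain z where z: "z \<in> ?D" "\<delta> z \<noteq> 0" "\<And>j. j \<notin> R \<Longrightarrow> peval (pd j (P j)) (($) (f z)) \<noteq> 0"
  proof (rule regular_nonzero_mult[of h \<delta> "\<lambda>x. \<Prod>j\<in>-R. peval (pd j (P j)) (($) (f x))" p UNIV p z0])
    show "regular h (\<lambda>x. \<Prod>j\<in>-R. peval (pd j (P j)) (($) (f x)))"
      by (intro regular_prod regular_peval_f)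
  qed (use \<delta> p z0 in auto)
  \<comment> \<open>Already the rows \<open>R\<close> of the augmented matrix have independent columns \<open>?S\<close>.\<close>
  define C where "C = (\<chi> i j. if i \<in> R then B z $ i $ j else 0)"
  have "indep_columns C ?S"
    unfolding indep_columns_def
  proof (intro allI impI)
    fix u assume u: "\<forall>j. j \<notin> ?S \<longrightarrow> u $ j = 0" "C *v u = 0"
    let ?v = "B z *v u"
    have vR: "?v $ i = 0" if "i \<in> R" for i
    proof -
      have "?v $ i = (C *v u) $ i" using that by (simp add: C_def matrix_vector_mult_def)
      then show ?thesis using u(2) by simp
    qed
    have "?v $ j = 0" if j: "j \<notin> R" for j
    proof -
      let ?d = "\<lambda>i. peval (pd i (P j)) (($) (f z))"
      have d0: "?d i = 0" if "i \<notin> insert j R" for i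
      proof -
        have "i \<notin> vars (P j)" using P(1)[OF j] that by blast
        from pd_eq_0_if_not_in_vars[OF this] show ?thesis by simp
      qed
      have "(\<Sum>i\<in>UNIV. ?d i * w z $ i) = 0"
        by (rule tan) (use P(2)[OF j] z in auto)
      moreover have "(\<Sum>i\<in>UNIV. ?d i * (J z *v v) $ i) = 0" for v
        by (rule relation_derivative[of UNIV "P j" "\<lambda>i x. f x $ i" "\<lambda>i v. (J z *v v) $ i" z UNIV z])
          (use f_has_derivative P(2)[OF j] z in auto)
      moreover have "(\<Sum>i\<in>UNIV. ?d i * ?v $ i) = u $ None * (\<Sum>i\<in>UNIV. ?d i * w z $ i)
          + (\<Sum>i\<in>UNIV. ?d i * (J z *v (\<chi> j. u $ Some j)) $ i)"
        unfolding B_mult by (simp add: sum_distrib_left algebra_simps sum.distrib)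
      ultimately have "(\<Sum>i\<in>UNIV. ?d i * ?v $ i) = 0" by simp
      moreover have "(\<Sum>i\<in>UNIV. ?d i * ?v $ i) = (\<Sum>i\<in>{j}. ?d i * ?v $ i)"
        by (rule sum.mono_neutral_right) (use d0 vR in auto)
      ultimately show ?thesis using z(3)[OF j] by simp
    qed
    with vR have "?v = 0" by (auto simp: vec_eq_iff)
    with indep_columnsD[OF \<delta>(3)[OF z(2)], of u] u(1) show "u = 0" by auto
  qed
  from card_le_rank[OF this] have "card ?S \<le> card R"
    using rank_le_card_rows[of R C] by (simp add: C_def)
  moreover have "card ?S = Suc (rank (J p))"
    using S(1) by (subst card_insert_disjoint) (auto simp: card_image)
  ultimately show False using cardR by simp
qed

text \<open>By the chain rule the differential of a polynomial vanishing on the image annihilates the column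
  space of the Jacobian. This settles the points of maximal rank, and a regular function vanishing at them is
  zero.\<close>

lemma derivative_zero_if_in_range_jacobian:
  assumes max: "\<And>q. q \<in> nonvanishing h \<Longrightarrow> rank (J q) \<le> rank (J p)"
    and p: "p \<in> nonvanishing h"
    and w_reg: "\<And>i. regular h (\<lambda>x. w x $ i)"
    and w: "\<And>x. x \<in> nonvanishing h \<Longrightarrow> rank (J x) = rank (J p) \<Longrightarrow> w x \<in> range ((*v) (J x))"
    and q: "\<And>y. y \<in> nonvanishing h \<Longrightarrow> peval q (($) (f y)) = 0"
    and x: "x \<in> nonvanishing h"
  shows "(\<Sum>i\<in>UNIV. peval (pd i q) (($) (f x)) * w x $ i) = 0"
proof -
  obtain S where S: "card S = rank (J p)" "indep_columns (J p) S" by (rule ex_indep_columns)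
  from regular_J S(2) obtain \<delta> where \<delta>: "regular h \<delta>" "\<delta> p \<noteq> 0" "\<And>x. \<delta> x \<noteq> 0 \<Longrightarrow> indep_columns (J x) S"
    by (rule indep_columns_open) (rule that)
  have reg: "regular h (\<lambda>x. \<Sum>i\<in>UNIV. peval (pd i q) (($) (f x)) * w x $ i)"
    by (intro regular_sum regular_mult regular_peval_f w_reg)
  show ?thesis
  proof (rule regular_mult_eq_0[OF reg \<delta>(1), of UNIV p p])
    fix x assume x: "x \<in> slice UNIV p \<inter> nonvanishing h"
    show "(\<Sum>i\<in>UNIV. peval (pd i q) (($) (f x)) * w x $ i) * \<delta> x = 0"
    proof (cases "\<delta> x = 0")
      case False
      then have "rank (J x) = rank (J p)"
        using card_le_rank[OF \<delta>(3)] max[of x] x S(1) by fastforce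
      then obtain v where v: "w x = J x *v v" using w[of x] x by auto
      have "(\<Sum>i\<in>UNIV. peval (pd i q) (\<lambda>i. f x $ i) * (J x *v v) $ i) = 0"
        by (rule relation_derivative[of UNIV q "\<lambda>i x. f x $ i" "\<lambda>i v. (J x *v v) $ i" x UNIV x])
          (use f_has_derivative q x in auto)
      then show ?thesis by (simp add: v)
    qed simp
  qed (use p x \<delta> in auto)
qed

end

section \<open>One-parameter groups of matrices\<close>

lemma matrix_power_bound:
  fixes A :: "complex^'n^'n"
  assumes "\<And>i j. norm (A $ i $ j) \<le> b"
  shows "norm (((**) A ^^ k) (mat 1) $ i $ j) \<le> (of_nat CARD('n) * b) ^ k"
proof (induction k arbitrary: i j)
  case 0
  then show ?case by (simp add: mat_def)
next
  case (Suc k)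
  have b: "b \<ge> 0" using assms norm_ge_zero order_trans by blast
  have "norm ((\<Sum>l\<in>UNIV. A $ i $ l * ((**) A ^^ k) (mat 1) $ l $ j)) \<le>
      (\<Sum>l\<in>(UNIV::'n set). b * (of_nat CARD('n) * b) ^ k)"
    by (rule order_trans[OF norm_sum], rule sum_mono)
      (simp only: norm_mult, intro mult_mono assms Suc.IH, use b in auto)
  moreover have "((**) A ^^ Suc k) (mat 1) $ i $ j = (\<Sum>l\<in>UNIV. A $ i $ l * ((**) A ^^ k) (mat 1) $ l $ j)"
    by (simp add: matrix_matrix_mult_def[of A "((**) A ^^ k) (mat 1)"])
  ultimately show ?case by (simp add: mult_ac)
qed

text \<open>\<open>E t\<close> is the matrix exponential \<open>exp (t A)\<close>, built entrywise from its power series. The product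
  \<open>E t ** E (- t)\<close> is constant because its derivative vanishes, \<open>A\<close> commuting with \<open>E t\<close>.\<close>

lemma ex_one_parameter_group:
  fixes A :: "complex^'n^'n"
  obtains E :: "complex \<Rightarrow> complex^'n^'n" where "E 0 = mat 1"
    "\<And>t i j. ((\<lambda>t. E t $ i $ j) has_field_derivative (A ** E t) $ i $ j) (at t)"
    "\<And>t. E t ** E (- t) = mat 1"
proof -
  define M where "M k = ((**) A ^^ k) (mat 1)" for k
  have M0: "M 0 = mat 1" and MS: "M (Suc k) = A ** M k" for k by (simp_all add: M_def)
  have MS': "M (Suc k) = M k ** A" for k
    by (induction k) (simp_all add: M0 MS matrix_mul_assoc)
  define c where "c i j k = M k $ i $ j / fact k" for i j k
  define E where "E t = (\<chi> i j. suminf (\<lambda>k. c i j k * t ^ k))" for t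
  define b where "b = (\<Sum>i\<in>UNIV. \<Sum>j\<in>UNIV. norm (A $ i $ j))"
  have b: "norm (A $ i $ j) \<le> b" for i j
  proof -
    have "norm (A $ i $ j) \<le> (\<Sum>j\<in>UNIV. norm (A $ i $ j))" by (rule member_le_sum) auto
    also have "\<dots> \<le> b" unfolding b_def by (rule member_le_sum) (auto intro: sum_nonneg)
    finally show ?thesis .
  qed
  have summ: "summable (\<lambda>k. c i j k * t ^ k)" for i j t
  proof (rule summable_comparison_test')
    show "summable (\<lambda>k. (of_nat CARD('n) * b * norm t) ^ k / fact k)"
      using summable_exp[of "of_nat CARD('n) * b * norm t"] by (simp add: divide_inverse mult.commute)
    fix k :: nat
    have "norm (c i j k * t ^ k) = norm (M k $ i $ j) * norm t ^ k / fact k"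
      by (simp add: c_def norm_mult norm_divide norm_power)
    also have "\<dots> \<le> (of_nat CARD('n) * b) ^ k * norm t ^ k / fact k"
      unfolding M_def by (intro divide_right_mono mult_right_mono matrix_power_bound b) auto
    finally show "norm (c i j k * t ^ k) \<le> (of_nat CARD('n) * b * norm t) ^ k / fact k"
      by (simp add: power_mult_distrib)
  qed
  have diffs_c: "diffs (c i j) k = M (Suc k) $ i $ j / fact k" for i j k
    unfolding diffs_def c_def by (simp add: field_simps del: of_nat_Suc)
  have E': "((\<lambda>t. E t $ i $ j) has_field_derivative suminf (\<lambda>k. diffs (c i j) k * t ^ k)) (at t)" for i j t
    using termdiffs_strong_converges_everywhere[OF summ] by (simp add: E_def)
  have left: "suminf (\<lambda>k. diffs (c i j) k * t ^ k) = (A ** E t) $ i $ j" for i j t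
  proof -
    have "suminf (\<lambda>k. diffs (c i j) k * t ^ k) = suminf (\<lambda>k. \<Sum>l\<in>UNIV. A $ i $ l * (c l j k * t ^ k))"
      by (simp add: diffs_c MS matrix_matrix_mult_def c_def sum_distrib_right sum_divide_distrib mult.assoc)
    also have "\<dots> = (\<Sum>l\<in>UNIV. A $ i $ l * suminf (\<lambda>k. c l j k * t ^ k))"
      by (subst suminf_sum) (auto intro!: summable_mult summ simp: suminf_mult[OF summ])
    finally show ?thesis by (simp add: E_def matrix_matrix_mult_def)
  qed
  have right: "suminf (\<lambda>k. diffs (c i j) k * t ^ k) = (E t ** A) $ i $ j" for i j t
  proof -
    have "suminf (\<lambda>k. diffs (c i j) k * t ^ k) = suminf (\<lambda>k. \<Sum>l\<in>UNIV. A $ l $ j * (c i l k * t ^ k))"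
      by (simp add: diffs_c MS' matrix_matrix_mult_def c_def sum_distrib_left sum_divide_distrib mult_ac)
    also have "\<dots> = (\<Sum>l\<in>UNIV. A $ l $ j * suminf (\<lambda>k. c i l k * t ^ k))"
      by (subst suminf_sum) (auto intro!: summable_mult summ simp: suminf_mult[OF summ])
    finally show ?thesis by (simp add: E_def matrix_matrix_mult_def mult.commute)
  qed
  have E0: "E 0 = mat 1"
    using powser_zero[of "c _ _"] by (simp add: E_def vec_eq_iff) (simp add: c_def M0)
  have derivL: "((\<lambda>t. E t $ i $ j) has_field_derivative (A ** E t) $ i $ j) (at t)" for t i j
    using E'[of i j t] by (simp add: left)
  have derivR: "((\<lambda>t. E t $ i $ j) has_field_derivative (E t ** A) $ i $ j) (at t)" for t i j
    using E'[of i j t] by (simp add: right)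
  have inv: "E t ** E (- t) = mat 1" for t
  proof -
    have "((\<lambda>t. (E t ** E (- t)) $ i $ j) has_field_derivative 0) (at t)" for i j t
    proof -
      have mm: "(P ** Q) $ i $ j = (\<Sum>l\<in>UNIV. P $ i $ l * Q $ l $ j)" for P Q :: "complex^'n^'n"
        by (simp add: matrix_matrix_mult_def)
      have neg: "((\<lambda>t. E (- t) $ l $ j) has_field_derivative - (A ** E (- t)) $ l $ j) (at t)" for l
      proof -
        have "((\<lambda>t. - t) has_field_derivative - 1) (at t)" by (auto intro!: derivative_eq_intros)
        from DERIV_chain2[where f = "\<lambda>t. E t $ l $ j" and g = uminus, OF derivL this] show ?thesis by simp
      qed
      have "((\<lambda>t. \<Sum>l\<in>UNIV. E t $ i $ l * E (- t) $ l $ j) has_field_derivative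
          (\<Sum>l\<in>UNIV. (E t ** A) $ i $ l * E (- t) $ l $ j + E t $ i $ l * (- (A ** E (- t)) $ l $ j))) (at t)"
        by (auto intro!: derivative_eq_intros derivR neg sum.cong simp: mult_ac)
      moreover have "(\<Sum>l\<in>UNIV. (E t ** A) $ i $ l * E (- t) $ l $ j + E t $ i $ l * (- (A ** E (- t)) $ l $ j))
          = ((E t ** A) ** E (- t)) $ i $ j - (E t ** (A ** E (- t))) $ i $ j"
        unfolding mm[of "E t ** A"] mm[of "E t" "A ** E (- t)"] by (simp add: sum_subtractf)
      ultimately show ?thesis by (simp add: matrix_mul_assoc mm[of "E _" "E _"])
    qed
    then have "\<exists>c. \<forall>t\<in>UNIV. (E t ** E (- t)) $ i $ j = c" for i j
      by (intro has_field_derivative_zero_constant) auto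
    then have "(E t ** E (- t)) $ i $ j = (E 0 ** E (- 0)) $ i $ j" for i j by (metis UNIV_I)
    then show ?thesis by (simp add: vec_eq_iff E0)
  qed
  show thesis by (rule that[OF E0 derivL inv])
qed

section \<open>The Lie algebra of the linear symmetry group\<close>

text \<open>The derivation of the polynomial ring induced by a matrix.\<close>

definition lie_deriv :: "complex^'n^'n \<Rightarrow> 'n::finite cpoly \<Rightarrow> 'n cpoly" where
  "lie_deriv A p = (\<Sum>i\<in>UNIV. pd i p * (\<Sum>j\<in>UNIV. Const (A $ i $ j) * Var j))"

lemma peval_lie_deriv:
  "peval (lie_deriv A p) (($) x) = (\<Sum>i\<in>UNIV. peval (pd i p) (($) x) * (A *v x) $ i)"
  by (simp add: lie_deriv_def peval_sum peval_mult matrix_vector_mult_def)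

text \<open>For a point \<open>x\<close> of \<open>X\<close> the equation \<open>p (g *v x) = 0\<close> is polynomial in the entries of \<open>g\<close> and holds
  on the symmetry group; its derivative at the identity is the derivation applied to \<open>p\<close>.\<close>

lemma lie_deriv_vanishes_if_in_lie_algebra:
  fixes X :: "(complex^'n::finite) set"
  assumes A: "A \<in> lie_algebra (sym_group X)" and p: "\<And>x. x \<in> X \<Longrightarrow> peval p (($) x) = 0" and x: "x \<in> X"
  shows "peval (lie_deriv A p) (($) x) = 0"
proof -
  obtain F :: "('n \<times> 'n) cpoly" where F: "\<And>G. peval F G = peval p (\<lambda>i. \<Sum>j\<in>UNIV. G (i, j) * x $ j)"
    using ex_subst[of p "\<lambda>i. \<Sum>j\<in>UNIV. Var (i, j) * Const (x $ j)"] by (auto simp: peval_sum peval_mult)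
  have "peval F (\<lambda>(i, j). g $ i $ j) = 0" if "g \<in> sym_group X" for g
  proof -
    have "g *v x \<in> X" using that x by (auto simp: sym_group_def)
    moreover have "($) (g *v x) = (\<lambda>i. \<Sum>j\<in>UNIV. g $ i $ j * x $ j)"
      by (simp add: fun_eq_iff matrix_vector_mult_def)
    ultimately show ?thesis using p[of "g *v x"] by (simp add: F)
  qed
  then have "deriv (\<lambda>t. peval F (\<lambda>(i, j). mat 1 $ i $ j + t * A $ i $ j)) 0 = 0"
    using A by (auto simp: lie_algebra_def)
  moreover have "peval F (\<lambda>(i, j). mat 1 $ i $ j + t * A $ i $ j) = peval p (\<lambda>i. x $ i + t * (A *v x) $ i)" for t
  proof -
    have "(\<Sum>j\<in>UNIV. (mat 1 $ i $ j + t * A $ i $ j) * x $ j) = (mat 1 *v x) $ i + t * (A *v x) $ i" for i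
      by (simp only: matrix_vector_mult_def vec_lambda_beta distrib_right sum.distrib sum_distrib_left mult.assoc)
    then show ?thesis by (simp add: F)
  qed
  moreover have "((\<lambda>t. peval p (\<lambda>i. x $ i + t * (A *v x) $ i)) has_field_derivative
      (\<Sum>i\<in>UNIV. peval (pd i p) (\<lambda>i. x $ i + 0 * (A *v x) $ i) * (A *v x) $ i)) (at 0)"
    by (rule peval_has_field_derivative) (auto intro!: derivative_eq_intros)
  ultimately show ?thesis by (simp add: peval_lie_deriv DERIV_imp_deriv)
qed

text \<open>If the vanishing ideal is stable under the derivation, then along an orbit of the one-parameter
  group a polynomial of the ideal has all derivatives zero at the start, so it vanishes identically;
  the group therefore consists of symmetries.\<close>

lemma in_lie_algebra_if_lie_deriv_vanishes:
  fixes X :: "(complex^'n::finite) set"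
  assumes X: "closedin zariski X"
    and stable: "\<And>p. (\<And>x. x \<in> X \<Longrightarrow> peval p (($) x) = 0) \<Longrightarrow> (\<And>x. x \<in> X \<Longrightarrow> peval (lie_deriv A p) (($) x) = 0)"
  shows "A \<in> lie_algebra (sym_group X)"
proof -
  obtain E :: "complex \<Rightarrow> complex^'n^'n" where E0: "E 0 = mat 1"
    and E': "\<And>t i j. ((\<lambda>t. E t $ i $ j) has_field_derivative (A ** E t) $ i $ j) (at t)"
    and inv: "\<And>t. E t ** E (- t) = mat 1"
    by (rule ex_one_parameter_group) (rule that)
  have EX: "E t *v x \<in> X" if x: "x \<in> X" for t x
  proof -
    have Ex': "((\<lambda>t. (E t *v x) $ i) has_field_derivative (A *v (E t *v x)) $ i) (at t)" for t i
    proof -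
      have "((\<lambda>t. \<Sum>j\<in>UNIV. E t $ i $ j * x $ j) has_field_derivative
          (\<Sum>j\<in>UNIV. (A ** E t) $ i $ j * x $ j)) (at t)"
        by (auto intro!: derivative_eq_intros E')
      moreover have "(A *v (E t *v x)) $ i = (\<Sum>j\<in>UNIV. (A ** E t) $ i $ j * x $ j)"
        unfolding matrix_vector_mul_assoc by (simp add: matrix_vector_mult_def)
      ultimately show ?thesis by (simp add: matrix_vector_mult_def[of "E _" x])
    qed
    have H: "((\<lambda>t. peval p (($) (E t *v x))) has_field_derivative peval (lie_deriv A p) (($) (E t *v x))) (at t)" for p t
      unfolding peval_lie_deriv by (rule peval_has_field_derivative) (auto intro: Ex')
    have iter: "(deriv ^^ n) (\<lambda>t. peval p (($) (E t *v x))) = (\<lambda>t. peval ((lie_deriv A ^^ n) p) (($) (E t *v x)))" for n p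
    proof (induction n)
      case (Suc n)
      then show ?case using H by (auto intro!: DERIV_imp_deriv)
    qed simp
    have van: "peval ((lie_deriv A ^^ n) p) (($) y) = 0" if "\<And>x. x \<in> X \<Longrightarrow> peval p (($) x) = 0" "y \<in> X" for n p y
      using that by (induction n arbitrary: y) (auto intro: stable)
    have "peval p (($) (E t *v x)) = 0" if p: "\<And>x. x \<in> X \<Longrightarrow> peval p (($) x) = 0" for p
    proof (rule holomorphic_fun_eq_0_on_connected[of "\<lambda>t. peval p (($) (E t *v x))" UNIV 0 t])
      show "(\<lambda>t. peval p (($) (E t *v x))) holomorphic_on UNIV"
        using H by (auto simp: holomorphic_on_open)
      show "(deriv ^^ n) (\<lambda>t. peval p (($) (E t *v x))) 0 = 0" for n
        unfolding iter using van[of p x n] p x by (simp add: E0)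
    qed auto
    moreover obtain P where "X = {x. \<forall>p\<in>P. peval p (($) x) = 0}" using X unfolding closedin_zariski by blast
    ultimately show ?thesis by auto
  qed
  have sym: "E t \<in> sym_group X" for t
  proof -
    have "E (- t) ** E t = mat 1" using inv[of "- t"] by simp
    then have "invertible (E t)" using inv[of t] unfolding invertible_def by blast
    moreover have "(*v) (E t) ` X = X"
    proof
      show "X \<subseteq> (*v) (E t) ` X"
      proof
        fix x assume "x \<in> X"
        then have "E (- t) *v x \<in> X" by (rule EX)
        moreover have "x = E t *v (E (- t) *v x)" by (simp add: matrix_vector_mul_assoc inv)
        ultimately show "x \<in> (*v) (E t) ` X" by blast
      qed
    qed (use EX in auto)
    ultimately show ?thesis by (simp add: sym_group_def)
  qed
  show ?thesis
    unfolding lie_algebra_def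
  proof (intro CollectI allI impI)
    fix F :: "('n \<times> 'n) cpoly" assume F: "\<forall>g\<in>sym_group X. peval F (\<lambda>(i, j). g $ i $ j) = 0"
    let ?I = "UNIV :: ('n \<times> 'n) set" and ?d = "\<lambda>k. peval (pd k F) (\<lambda>(i, j). mat 1 $ i $ j)"
    have "((\<lambda>t. peval F (\<lambda>k. E t $ fst k $ snd k)) has_field_derivative
        (\<Sum>k\<in>?I. peval (pd k F) (\<lambda>k. E 0 $ fst k $ snd k) * (A ** E 0) $ fst k $ snd k)) (at 0)"
      by (rule peval_has_field_derivative) (auto intro: E')
    moreover have "peval F (\<lambda>k. E t $ fst k $ snd k) = 0" for t
      using F sym[of t] by (auto simp: case_prod_beta')
    ultimately have "(\<Sum>k\<in>?I. ?d k * A $ fst k $ snd k) = 0"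
      using DERIV_unique[OF _ DERIV_const[of 0]] by (simp add: E0 case_prod_beta')
    moreover have "((\<lambda>t. peval F (\<lambda>k. mat 1 $ fst k $ snd k + t * A $ fst k $ snd k)) has_field_derivative
        (\<Sum>k\<in>?I. peval (pd k F) (\<lambda>k. mat 1 $ fst k $ snd k + 0 * A $ fst k $ snd k) * A $ fst k $ snd k)) (at 0)"
      by (rule peval_has_field_derivative) (auto intro!: derivative_eq_intros)
    ultimately show "deriv (\<lambda>t. peval F (\<lambda>(i, j). mat 1 $ i $ j + t * A $ i $ j)) 0 = 0"
      by (simp add: case_prod_beta' DERIV_imp_deriv)
  qed
qed

section \<open>Rational maps\<close>

lemma common_denominator:
  fixes \<phi> :: "('m::{finite,linorder}, 'n::finite) ratmap" and b :: "'n \<Rightarrow> 'm cpoly"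
  assumes "\<And>i. \<phi> $ i = Fract (a i) (b i)" "\<And>i. b i \<noteq> 0"
  shows "\<exists>a'. \<forall>i. \<phi> $ i = Fract (a' i) (\<Prod>i\<in>UNIV. b i)"
proof (intro exI allI)
  fix i
  let ?c = "\<Prod>k\<in>UNIV - {i}. b k"
  have "?c \<noteq> 0" using assms(2) by (simp add: prod_zero_iff)
  then have "Fract (a i) (b i) = Fract (?c * a i) (?c * b i)" by (rule mult_fract_cancel[symmetric])
  moreover have "?c * b i = (\<Prod>i\<in>UNIV. b i)" by (simp add: prod.remove[of UNIV i] mult.commute)
  ultimately show "\<phi> $ i = Fract (?c * a i) (\<Prod>i\<in>UNIV. b i)" using assms(1) by simp
qed

text \<open>A chart: near each point of its domain of definition a rational map has a common denominator \<open>h\<close>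
  that does not vanish there, and on the complement of \<open>h = 0\<close> it is a regular map. Different points may
  require different denominators.\<close>

lemma ex_chart:
  fixes \<phi> :: "('m::{finite,linorder}, 'n::finite) ratmap"
  assumes "defined_at \<phi> p"
  obtains h a where "p \<in> nonvanishing h" "\<And>i. \<phi> $ i = Fract (a i) h"
proof -
  have "\<forall>i. \<exists>a b. \<phi> $ i = Fract a b \<and> peval b (($) p) \<noteq> 0"
    using assms by (auto simp: defined_at_def rat_defined_at_def)
  then obtain a b where ab: "\<And>i. \<phi> $ i = Fract (a i) (b i)" "\<And>i. peval (b i) (($) p) \<noteq> 0"
    by (simp only: choice_iff) blast
  have "b i \<noteq> 0" for i using ab(2)[of i] by auto
  with common_denominator[of \<phi> a b] ab(1) obtain a' where "\<forall>i. \<phi> $ i = Fract (a' i) (\<Prod>i\<in>UNIV. b i)" by blast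
  moreover have "p \<in> nonvanishing (\<Prod>i\<in>UNIV. b i)" using ab(2) by (simp add: peval_prod prod_zero_iff)
  ultimately show thesis using that by blast
qed

lemma ex_defined_at:
  fixes \<phi> :: "('m::{finite,linorder}, 'n::finite) ratmap"
  shows "\<exists>p. defined_at \<phi> p"
proof -
  have "\<forall>i. \<exists>a b. \<phi> $ i = Fract a b \<and> b \<noteq> 0" by (metis Fract_cases)
  then obtain a b where ab: "\<And>i. \<phi> $ i = Fract (a i) (b i)" "\<And>i. b i \<noteq> 0"
    by (simp only: choice_iff) blast
  have "(\<Prod>i\<in>UNIV. b i) \<noteq> 0" using ab(2) by (simp add: prod_zero_iff)
  then obtain p :: "complex^'m::{finite,linorder}" where "peval (\<Prod>i\<in>UNIV. b i) (($) p) \<noteq> 0" using ex_peval_nonzero by blast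
  then have "peval (b i) (($) p) \<noteq> 0" for i by (simp add: peval_prod prod_zero_iff)
  then show ?thesis using ab(1) unfolding defined_at_def rat_defined_at_def by blast
qed

context
  fixes \<phi> :: "('m::{finite,linorder}, 'n::finite) ratmap" and h :: "'m cpoly" and a :: "'n \<Rightarrow> 'm cpoly"
  assumes chart: "\<And>i. \<phi> $ i = Fract (a i) h"
begin

lemma defined_at_chart: "x \<in> nonvanishing h \<Longrightarrow> defined_at \<phi> x"
  unfolding defined_at_def rat_defined_at_def using chart by blast

lemma rat_eval_chart: "x \<in> nonvanishing h \<Longrightarrow> rat_eval (\<phi> $ i) x = peval (a i) (($) x) / peval h (($) x)"
  by (simp add: chart rat_eval_Fract)

lemma rat_eval_has_derivative:
  assumes x: "x \<in> nonvanishing h"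
  shows "(rat_eval (\<phi> $ i) has_derivative (\<lambda>v. \<Sum>j\<in>UNIV. peval (pd j (a i) * h - a i * pd j h) (($) x) / peval h (($) x) ^ 2 * v $ j)) (at x)"
proof -
  have "((\<lambda>x. peval (a i) (($) x) / peval h (($) x)) has_derivative
      (\<lambda>v. ((\<Sum>j\<in>UNIV. peval (pd j (a i)) (($) x) * v $ j) * peval h (($) x) -
        peval (a i) (($) x) * (\<Sum>j\<in>UNIV. peval (pd j h) (($) x) * v $ j)) / (peval h (($) x) * peval h (($) x)))) (at x)"
    using x by (intro has_derivative_divide' peval_vec_has_derivative) simp
  then have "((\<lambda>x. peval (a i) (($) x) / peval h (($) x)) has_derivative
      (\<lambda>v. \<Sum>j\<in>UNIV. peval (pd j (a i) * h - a i * pd j h) (($) x) / peval h (($) x) ^ 2 * v $ j)) (at x)"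
    by (rule has_derivative_eq_rhs)
      (simp add: peval_diff peval_mult sum_distrib_left sum_distrib_right sum_subtractf[symmetric]
        sum_divide_distrib power2_eq_square algebra_simps)
  then show ?thesis
    by (rule has_derivative_transform_within_open[OF _ open_nonvanishing x]) (simp add: rat_eval_chart)
qed

lemma rat_jacobian_chart:
  assumes x: "x \<in> nonvanishing h"
  shows "rat_jacobian \<phi> x $ i $ j = peval (pd j (a i) * h - a i * pd j h) (($) x) / peval h (($) x) ^ 2"
proof -
  let ?l = "\<lambda>z. \<chi> k. if k = j then z else x $ k"
  let ?d = "\<lambda>j. peval (pd j (a i) * h - a i * pd j h) (($) x) / peval h (($) x) ^ 2"
  have l: "?l z = x + axis j (z - x $ j)" for z by (auto simp: vec_eq_iff axis_def)
  have lx: "?l (x $ j) = x" by (simp add: vec_eq_iff)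
  have bl: "bounded_linear (axis j :: complex \<Rightarrow> complex^'m::{finite,linorder})"
    by (rule bounded_linearI'[of "axis j"]) (auto simp: vec_eq_iff axis_def)
  have "((\<lambda>z. axis j (z - x $ j)) has_derivative (\<lambda>t. axis j (t - 0))) (at (x $ j))"
    by (rule bounded_linear.has_derivative[OF bl has_derivative_diff[OF has_derivative_ident has_derivative_const]])
  from has_derivative_add[OF has_derivative_const[of x] this]
  have "(?l has_derivative (\<lambda>t. axis j t)) (at (x $ j))" unfolding l by simp
  moreover have "(rat_eval (\<phi> $ i) has_derivative (\<lambda>v. \<Sum>j\<in>UNIV. ?d j * v $ j)) (at (?l (x $ j)))"
    unfolding lx by (rule rat_eval_has_derivative[OF x])
  ultimately have "((\<lambda>z. rat_eval (\<phi> $ i) (?l z)) has_derivative (\<lambda>t. \<Sum>k\<in>UNIV. ?d k * axis j t $ k)) (at (x $ j))"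
    by (rule has_derivative_compose)
  also have "(\<lambda>t. \<Sum>k\<in>UNIV. ?d k * axis j t $ k) = (*) (?d j)"
    by (auto simp: axis_def if_distrib cong: if_cong)
  finally have "((\<lambda>z. rat_eval (\<phi> $ i) (?l z)) has_field_derivative ?d j) (at (x $ j))"
    unfolding has_field_derivative_def .
  from DERIV_imp_deriv[OF this] show ?thesis by (simp add: rat_jacobian_def)
qed

lemma regular_map_chart:
  assumes "nonvanishing h \<noteq> {}"
  shows "regular_map h (map_eval \<phi>) (rat_jacobian \<phi>)"
proof
  show "regular h (\<lambda>x. map_eval \<phi> x $ i)" for i
    by (rule regularI[of _ _ "a i" 1]) (simp add: map_eval_def rat_eval_chart)
  show "regular h (\<lambda>x. rat_jacobian \<phi> x $ i $ j)" for i j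
    by (rule regularI[of _ _ "pd j (a i) * h - a i * pd j h" 2]) (simp add: rat_jacobian_chart)
  fix x i assume x: "x \<in> nonvanishing h"
  show "((\<lambda>x. map_eval \<phi> x $ i) has_derivative (\<lambda>v. (rat_jacobian \<phi> x *v v) $ i)) (at x)"
    using rat_eval_has_derivative[OF x, of i]
    by (simp add: map_eval_def matrix_vector_mult_def rat_jacobian_chart[OF x])
qed fact

end

lemma nonvanishing_meet:
  fixes h :: "'m::{finite,linorder} cpoly"
  assumes "h \<noteq> 0" "h' \<noteq> 0" shows "\<exists>x. x \<in> nonvanishing h \<inter> nonvanishing h'"
  using ex_peval_nonzero[of "h * h'"] assms by (auto simp: peval_mult)

text \<open>The image of a single chart is already dense in the image: in any other chart, a polynomial
  vanishing on it pulls back to a regular function that is zero on the nonempty open overlap.\<close>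

lemma image_closure_chart:
  fixes \<phi> :: "('m::{finite,linorder}, 'n::finite) ratmap"
  assumes chart: "\<And>i. \<phi> $ i = Fract (a i) h" and p: "p \<in> nonvanishing h"
  shows "image_closure \<phi> = zariski closure_of (map_eval \<phi> ` nonvanishing h)"
proof (rule antisym)
  show "zariski closure_of (map_eval \<phi> ` nonvanishing h) \<subseteq> image_closure \<phi>"
    unfolding image_closure_def using defined_at_chart[OF chart] by (intro closure_of_mono) auto
  have "peval q (($) (map_eval \<phi> x)) = 0"
    if q: "\<forall>y\<in>map_eval \<phi> ` nonvanishing h. peval q (($) y) = 0" and x: "defined_at \<phi> x" for q x
  proof -
    obtain h' a' where x': "x \<in> nonvanishing h'" and chart': "\<And>i. \<phi> $ i = Fract (a' i) h'"
      using ex_chart[OF x] by blast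
    interpret regular_map h' "map_eval \<phi>" "rat_jacobian \<phi>"
      by (rule regular_map_chart[OF chart']) (use x' in auto)
    obtain y where y: "y \<in> nonvanishing h \<inter> nonvanishing h'"
      using nonvanishing_meet[of h h'] p x' by fastforce
    show ?thesis
    proof (rule regular_mult_eq_0[OF regular_peval_f[of q] regular_peval[of h' h], of UNIV x y])
      show "peval q (($) (map_eval \<phi> z)) * peval h (($) z) = 0" for z
        using q by (cases "z \<in> nonvanishing h") auto
    qed (use x' y in auto)
  qed
  then show "image_closure \<phi> \<subseteq> zariski closure_of (map_eval \<phi> ` nonvanishing h)"
    unfolding image_closure_def zariski_closure_of by blast
qed

theorem corollary2p3:
  fixes \<phi> :: "('m::{finite,linorder}, 'n::finite) ratmap"
  shows "(\<exists>V. openin zariski V \<and> zariski closure_of V = UNIV \<and> V \<subseteq> full_rank_locus \<phi>) \<and>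
         lie_algebra (sym_group (image_closure \<phi>)) =
           {A. \<forall>p\<in>full_rank_locus \<phi>.
                 A *v map_eval \<phi> p \<in> range (\<lambda>v. rat_jacobian \<phi> p *v v)}"
proof -
  let ?f = "map_eval \<phi>" and ?J = "rat_jacobian \<phi>" and ?X = "image_closure \<phi>"
  have "rank (?J q) \<le> CARD('n)" for q by (rule rank_le_card_rows) simp
  then have bound: "\<forall>q. defined_at \<phi> q \<longrightarrow> rank (?J q) < Suc CARD('n)" by (simp add: less_Suc_eq_le)
  obtain q0 where "defined_at \<phi> q0" using ex_defined_at by blast
  from ex_has_greatest_nat[OF this bound] obtain p0 where p0: "defined_at \<phi> p0"
    and max: "\<And>q. defined_at \<phi> q \<Longrightarrow> rank (?J q) \<le> rank (?J p0)" by blast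
  obtain h a where hp0: "p0 \<in> nonvanishing h" and chart: "\<And>i. \<phi> $ i = Fract (a i) h"
    using ex_chart[OF p0] by blast
  interpret regular_map h ?f ?J
    by (rule regular_map_chart[OF chart]) (use hp0 in auto)
  have X: "?X = zariski closure_of (?f ` nonvanishing h)"
    by (rule image_closure_chart[OF chart hp0])
  have max_h: "rank (?J q) \<le> rank (?J p0)" if "q \<in> nonvanishing h" for q
    using max defined_at_chart[OF chart that] by blast
  have "zariski_dim ?X = enat (rank (?J p0))"
    unfolding X using zariski_dim_le_rank[OF max_h] rank_le_zariski_dim[OF hp0] by (rule antisym)
  then have locus: "full_rank_locus \<phi> = {p. defined_at \<phi> p \<and> rank (?J p) = rank (?J p0)}"
    by (simp add: full_rank_locus_def)
  \<comment> \<open>The open set is where the columns independent at \<open>p0\<close> stay independent; the factor \<open>h\<close> of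
    its equation keeps it inside the chart.\<close>
  have "\<exists>V. openin zariski V \<and> zariski closure_of V = UNIV \<and> V \<subseteq> full_rank_locus \<phi>"
  proof -
    obtain S where S: "card S = rank (?J p0)" "indep_columns (?J p0) S" by (rule ex_indep_columns)
    from regular_J S(2) obtain \<delta> where \<delta>: "regular h \<delta>" "\<delta> p0 \<noteq> 0" "\<And>x. \<delta> x \<noteq> 0 \<Longrightarrow> indep_columns (?J x) S"
      by (rule indep_columns_open) (rule that)
    from \<delta>(1) obtain b N where b: "\<forall>x\<in>nonvanishing h. \<delta> x = peval b (($) x) / peval h (($) x) ^ N"
      unfolding regular_def by blast
    let ?V = "nonvanishing (b * h)"
    have V: "x \<in> nonvanishing h \<and> \<delta> x \<noteq> 0" if "x \<in> ?V" for x using that b by (simp add: peval_mult)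
    have p0V: "p0 \<in> ?V" using \<delta>(2) hp0 b by (simp add: peval_mult)
    have "openin zariski ?V" unfolding openin_zariski by (rule exI[of _ "{b * h}"]) simp
    moreover have "peval q (($) x) = 0" if q: "\<forall>y\<in>?V. peval q (($) y) = 0" for q x
    proof (rule regular_mult_eq_0[of 1 "\<lambda>x. peval q (($) x)" "\<lambda>x. peval (b * h) (($) x)" UNIV p0 p0])
      show "peval q (($) z) * peval (b * h) (($) z) = 0" for z
        using q by (cases "z \<in> ?V") auto
    qed (use p0V in \<open>auto intro: regular_peval\<close>)
    then have "zariski closure_of ?V = UNIV" unfolding zariski_closure_of by blast
    moreover have "?V \<subseteq> full_rank_locus \<phi>"
    proof
      fix x assume "x \<in> ?V"
      then have x: "x \<in> nonvanishing h" "\<delta> x \<noteq> 0" using V by auto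
      then have "rank (?J x) = rank (?J p0)"
        using card_le_rank[OF \<delta>(3)] max_h[OF x(1)] S(1) by fastforce
      then show "x \<in> full_rank_locus \<phi>" using defined_at_chart[OF chart x(1)] by (simp add: locus)
    qed
    ultimately show ?thesis by blast
  qed
  \<comment> \<open>Here \<open>p\<close> is an arbitrary point of maximal rank and may lie outside the chart of \<open>p0\<close>.\<close>
  moreover have "A *v ?f p \<in> range ((*v) (?J p))"
    if A: "A \<in> lie_algebra (sym_group ?X)" and p: "p \<in> full_rank_locus \<phi>" for A p
  proof -
    have pd: "defined_at \<phi> p" and pr: "rank (?J p) = rank (?J p0)" using p by (auto simp: locus)
    obtain h' a' where p': "p \<in> nonvanishing h'" and chart': "\<And>i. \<phi> $ i = Fract (a' i) h'"
      using ex_chart[OF pd] by blast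
    interpret p: regular_map h' ?f ?J
      by (rule regular_map_chart[OF chart']) (use p' in auto)
    have X': "?X = zariski closure_of (?f ` nonvanishing h')"
      by (rule image_closure_chart[OF chart' p'])
    show ?thesis
    proof (rule p.tangent_in_range_jacobian[OF _ p'])
      show "rank (?J q) \<le> rank (?J p)" if "q \<in> nonvanishing h'" for q
        using max defined_at_chart[OF chart' that] pr by simp
      show "regular h' (\<lambda>x. (A *v ?f x) $ i)" for i
        by (auto simp: matrix_vector_mult_def intro!: regular_sum regular_mult regular_const p.regular_f)
      fix q x assume q: "\<And>y. y \<in> nonvanishing h' \<Longrightarrow> peval q (($) (?f y)) = 0" and x: "x \<in> nonvanishing h'"
      have "peval q (($) y) = 0" if "y \<in> ?X" for y
        using that q unfolding X' zariski_closure_of by blast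
      moreover have "?f x \<in> ?X"
        unfolding X' using x closure_of_subset[of "?f ` nonvanishing h'" zariski] by auto
      ultimately have "peval (lie_deriv A q) (($) (?f x)) = 0"
        using lie_deriv_vanishes_if_in_lie_algebra[OF A] by blast
      then show "(\<Sum>i\<in>UNIV. peval (pd i q) (($) (?f x)) * (A *v ?f x) $ i) = 0"
        by (simp add: peval_lie_deriv)
    qed
  qed
  moreover have "A \<in> lie_algebra (sym_group ?X)"
    if A: "\<forall>p\<in>full_rank_locus \<phi>. A *v ?f p \<in> range ((*v) (?J p))" for A
  proof (rule in_lie_algebra_if_lie_deriv_vanishes)
    show "closedin zariski ?X" unfolding X by (rule closedin_closure_of)
    fix q y assume q: "\<And>x. x \<in> ?X \<Longrightarrow> peval q (($) x) = 0" and y: "y \<in> ?X"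
    have fX: "?f x \<in> ?X" if "x \<in> nonvanishing h" for x
      unfolding X using that closure_of_subset[of "?f ` nonvanishing h" zariski] by auto
    have "peval (lie_deriv A q) (($) (?f x)) = 0" if x: "x \<in> nonvanishing h" for x
      unfolding peval_lie_deriv
    proof (rule derivative_zero_if_in_range_jacobian[OF max_h hp0 _ _ _ x])
      show "regular h (\<lambda>x. (A *v ?f x) $ i)" for i
        by (auto simp: matrix_vector_mult_def intro!: regular_sum regular_mult regular_const regular_f)
      show "A *v ?f x \<in> range ((*v) (?J x))" if "x \<in> nonvanishing h" "rank (?J x) = rank (?J p0)" for x
        using A that defined_at_chart[OF chart that(1)] by (auto simp: locus)
    qed (use q fX in auto)
    then show "peval (lie_deriv A q) (($) y) = 0"
      using y unfolding X zariski_closure_of by blast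
  qed
  ultimately show ?thesis by auto
qed

end
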